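(* Let $p\ge 19$ be prime, $0<\alpha\le1/2$, and $\alpha^{3+e^{-133}}\le\beta\le\alpha^3\min(p^{-\log p},p^{-50})$. Then $$n_p(\alpha,\beta)\ge \mathrm{Tow}\!\left(p,\tfrac{1}{30}(\log p)\ln\!\Big(\tfrac{\log(1/\alpha)}{\log(\alpha^3/\beta)}\Big),\alpha^3/\beta\right);$$ that is, there is $n$ at least this large and a set $A\subseteq\mathbb{F}_p^n$ of density at least $\alpha$ such that for every nonzero $d\in\mathbb{F}_p^n$ the density of 3-APs in $A$ with common difference $d$ is less than $\beta$.
   Context: For a prime $p$, $A\subseteq\mathbb{F}_p^n$ has density $|A|/p^n$; the density of 3-APs in $A$ with common difference $d$ is $p^{-n}|\{x: x,x+d,x+2d\in A\}|$. $n_p(\alpha,\beta)$ is the least positive integer $N$ such that for all $n\ge N$ and all $A\subseteq\mathbb{F}_p^n$ of density at least $\alpha$ some nonzero $d$ has 3-AP density at least $\beta$. $\mathrm{Tow}(a,0,r)=r$, $\mathrm{Tow}(a,k+1,r)=a^{\mathrm{Tow}(a,k,r)}$, non-integer heights rounded down. $\log$ is base 2, $\ln$ natural. *)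

theory Defs
  imports Complex_Main "HOL-Computational_Algebra.Primes"
begin

definition Fpn :: "nat \<Rightarrow> nat \<Rightarrow> (nat \<Rightarrow> nat) set" where
  "Fpn p n = {x. (\<forall>i<n. x i < p) \<and> (\<forall>i\<ge>n. x i = 0)}"

definition vadd :: "nat \<Rightarrow> (nat \<Rightarrow> nat) \<Rightarrow> (nat \<Rightarrow> nat) \<Rightarrow> (nat \<Rightarrow> nat)" where
  "vadd p x y = (\<lambda>i. (x i + y i) mod p)"

definition density :: "nat \<Rightarrow> nat \<Rightarrow> (nat \<Rightarrow> nat) set \<Rightarrow> real" where
  "density p n A = real (card A) / real p ^ n"

definition ap3_density :: "nat \<Rightarrow> nat \<Rightarrow> (nat \<Rightarrow> nat) set \<Rightarrow> (nat \<Rightarrow> nat) \<Rightarrow> real" where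
  "ap3_density p n A d =
     real (card {x \<in> Fpn p n. x \<in> A \<and> vadd p x d \<in> A \<and> vadd p (vadd p x d) d \<in> A})
     / real p ^ n"

fun tow :: "real \<Rightarrow> nat \<Rightarrow> real \<Rightarrow> real" where
  "tow a 0 r = r"
| "tow a (Suc k) r = a powr (tow a k r)"

definition Tow :: "real \<Rightarrow> real \<Rightarrow> real \<Rightarrow> real" where
  "Tow a h r = tow a (nat \<lfloor>h\<rfloor>) r"

end

theory Submission
  imports Defs "HOL-Analysis.Harmonic_Numbers"
begin

text \<open>Call a set of density \<open>\<mu>\<close> sparse if every nonzero difference has 3-AP density at most
  \<open>\<mu>\<^sup>3 / R\<close>. Given a sparse \<open>S \<subseteq> F\<^sub>p\<^sup>m\<close> and a progression-free \<open>T \<subseteq> F\<^sub>p\<^sup>s\<close>, choose random linear maps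
  \<open>V\<^sub>x : F\<^sub>p\<^sup>n \<rightarrow> F\<^sub>p\<^sup>s\<close> for \<open>x \<in> S\<close> and put \<open>S' = {(x, y). x \<in> S \<and> V\<^sub>x y \<in> T}\<close>. Any three of the maps are
  jointly independent, so a difference \<open>(d, e)\<close> with \<open>d \<noteq> 0\<close> inherits the bound for \<open>d\<close>; a difference
  \<open>(0, e)\<close> only sees the points with \<open>V\<^sub>x e = 0\<close>, about a fraction \<open>1 / p\<^sup>s\<close> of all. The union
  bound over \<open>e\<close> allows \<open>n\<close> to be exponential in \<open>m\<close>, so each step adds a level to the tower,
  while with spheres in the box \<open>[0, (p - 1) / 2]\<^sup>s\<close> as \<open>T\<close> (Behrend) the logarithm of the density grows only by a factor
  \<open>1 + O(1 / log p)\<close>.\<close>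

section \<open>Counting solutions of independent linear conditions\<close>

text \<open>The new dimension \<open>n\<close> is squeezed from both sides; let \<mu>, \<tau> be the
  densities of \<open>S\<close>, \<open>T\<close>. The union bound over the p^n vectors
  \<open>e\<close> tolerates fewer than \<open>n\<close> maps killing each \<open>e\<close>, which
  needs \<open>n\<close> at least of order p^2 |S| / p^s. Those maps leave progressions of density
  at most n \<tau> / p^m, and this must stay below (\<mu> \<tau>)^3 / R, so \<open>n\<close> is at
  most \<mu>^3 \<tau>^2 p^m / R. The window is open only if p^s is of order p^2 R / (\<mu>
  \<tau>)^2: \<open>s\<close> has to be proportional to the logarithmic density already lost,
  divided by log p. A Behrend set costs at most 5/4 bit per coordinate, so one level multiplies the
  loss by at most exp(15 / log p). It starts at a multiple of log(\<alpha>^3/\<beta>) and may grow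
  to a fixed fraction of log(1/\<alpha>); the number of levels is therefore of order log p times the
  natural logarithm of their ratio, which is the height in the theorem. The factor \<open>R\<close>
  is never spent: differences with nonzero first block inherit it unchanged, and only the
  differences (0, e) have to be paid for anew at each level.\<close>

lemma bij_betw_PiE_Fpn:
  "bij_betw (\<lambda>f i. if i < n then f i else 0) (PiE {..<n} (\<lambda>_. {..<p})) (Fpn p n)"
  by (rule bij_betwI[where g = "\<lambda>x. restrict x {..<n}"])
    (auto simp: Fpn_def PiE_def Pi_def extensional_def restrict_def fun_eq_iff)

lemma finite_Fpn [simp]: "finite (Fpn p n)"
  using bij_betw_finite[OF bij_betw_PiE_Fpn, of n p] by (auto intro!: finite_PiE)

lemma card_Fpn [simp]: "card (Fpn p n) = p ^ n"
  using bij_betw_same_card[OF bij_betw_PiE_Fpn, of n p] by (simp add: card_PiE)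

lemma sum_Fpn_prod:
  fixes f :: "nat \<Rightarrow> nat \<Rightarrow> 'a::comm_semiring_1"
  shows "(\<Sum>y\<in>Fpn p n. \<Prod>i<n. f i (y i)) = (\<Prod>i<n. \<Sum>t<p. f i t)"
  by (subst sum.reindex_bij_betw[OF bij_betw_PiE_Fpn, symmetric])
    (simp add: prod_sum_PiE)

definition dot :: "nat \<Rightarrow> (nat \<Rightarrow> nat) \<Rightarrow> (nat \<Rightarrow> nat) \<Rightarrow> nat" where
  "dot n a y = (\<Sum>i<n. a i * y i)"

definition root1 :: "nat \<Rightarrow> complex" where
  "root1 p = cis (2 * pi / p)"

lemma root1_power_eq_1_iff:
  assumes "p > 0" shows "root1 p ^ k = 1 \<longleftrightarrow> p dvd k"
proof -
  have "root1 p ^ k = cis (k * (2 * pi / p))"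
    unfolding root1_def by (rule Complex.DeMoivre)
  moreover have "cis (k * (2 * pi / p)) = 1 \<longleftrightarrow> (\<exists>m::int. k * (2 * pi / p) = 2 * pi * m)"
  proof
    assume "cis (k * (2 * pi / p)) = 1"
    then have "cos (k * (2 * pi / p)) = 1" by (metis cis.sel(1) one_complex.sel(1))
    then show "\<exists>m::int. k * (2 * pi / p) = 2 * pi * m"
      unfolding cos_one_2pi_int by (auto simp: algebra_simps)
  qed auto
  moreover have "(\<exists>m::int. k * (2 * pi / p) = 2 * pi * m) \<longleftrightarrow> p dvd k"
  proof
    assume "\<exists>m::int. k * (2 * pi / p) = 2 * pi * m"
    then obtain m :: int where "k * (2 * pi / p) = 2 * pi * m" by blast
    then have "real k = real_of_int (m * int p)" using assms by (simp add: field_simps)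
    then have "int k = m * int p" by linarith
    then show "p dvd k" by (metis dvd_triv_right int_dvd_int_iff)
  next
    assume "p dvd k"
    then obtain c where "k = p * c" by blast
    then show "\<exists>m::int. k * (2 * pi / p) = 2 * pi * m"
      using assms by (intro exI[of _ "int c"]) (simp add: field_simps)
  qed
  ultimately show ?thesis by simp
qed

lemma sum_root1:
  assumes "p > 0" shows "(\<Sum>c<p. root1 p ^ (c * a)) = (if p dvd a then of_nat p else 0)"
proof (cases "p dvd a")
  case True
  then have "root1 p ^ a = 1" using root1_power_eq_1_iff[OF assms] by simp
  then have "root1 p ^ (c * a) = 1" for c by (simp add: power_mult mult.commute[of c])
  with True show ?thesis by simp
next
  case False
  then have ne: "root1 p ^ a \<noteq> 1" using root1_power_eq_1_iff[OF assms] by simp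
  have "(\<Sum>c<p. root1 p ^ (c * a)) = (\<Sum>c<p. (root1 p ^ a) ^ c)"
    by (simp add: power_mult mult.commute[of _ a])
  also have "\<dots> = ((root1 p ^ a) ^ p - 1) / (root1 p ^ a - 1)"
    using ne by (rule geometric_sum)
  also have "(root1 p ^ a) ^ p = 1"
    using root1_power_eq_1_iff[OF assms, of "a * p"] by (simp add: power_mult)
  finally show ?thesis using False by simp
qed

text \<open>Linear independence over F_p of the rows \<open>R q\<close>, cut to their first
  \<open>n\<close> coordinates. Using \<open>PiE\<close> makes the coefficient vectors a finite set,
  over which characters are summed and bad families are counted.\<close>

definition indep :: "nat \<Rightarrow> nat \<Rightarrow> ('q \<Rightarrow> nat \<Rightarrow> nat) \<Rightarrow> 'q set \<Rightarrow> bool" where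
  "indep p n R Q \<longleftrightarrow> (\<forall>c\<in>PiE Q (\<lambda>_. {..<p}).
     (\<forall>i<n. p dvd (\<Sum>q\<in>Q. c q * R q i)) \<longrightarrow> (\<forall>q\<in>Q. c q = 0))"

text \<open>Both conditions are detected by additive characters; after summing over \<open>y\<close>, independence
  kills every character except the trivial one.\<close>

lemma indep_fibre_card:
  fixes R :: "'q \<Rightarrow> nat \<Rightarrow> nat"
  assumes p: "p > 0" and Q: "finite Q" and ind: "indep p n R Q"
    and w: "\<And>q. q \<in> Q \<Longrightarrow> w q < p"
  shows "card {y \<in> Fpn p n. \<forall>q\<in>Q. dot n (R q) y mod p = w q} * p ^ card Q = p ^ n"
proof -
  let ?C = "PiE Q (\<lambda>_. {..<p})"
  let ?\<omega> = "root1 p"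
  \<comment> \<open>Adding \<open>p - w q\<close> replaces subtraction of \<open>w q\<close>, so the
    condition becomes divisibility of a natural number by \<open>p\<close>.\<close>
  define a where "a q y = dot n (R q) y + (p - w q)" for q y
  have fin: "finite ?C" using Q by (intro finite_PiE) auto
  have dvd: "p dvd a q y \<longleftrightarrow> dot n (R q) y mod p = w q" if "q \<in> Q" for q y
  proof -
    have "int (a q y) = int (dot n (R q) y) - int (w q) + int p"
      using w[OF that] unfolding a_def by simp
    then have "p dvd a q y \<longleftrightarrow> int p dvd int (dot n (R q) y) - int (w q)"
      by (metis dvd_add_triv_right_iff int_dvd_int_iff)
    also have "\<dots> \<longleftrightarrow> int (dot n (R q) y) mod int p = int (w q) mod int p"
      by (rule mod_eq_dvd_iff[symmetric])
    also have "\<dots> \<longleftrightarrow> dot n (R q) y mod p = w q"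
      using w[OF that] by (metis mod_less of_nat_eq_iff zmod_int)
    finally show ?thesis .
  qed
  have ind_eq: "(\<Sum>c\<in>?C. ?\<omega> ^ (\<Sum>q\<in>Q. c q * a q y))
      = (if \<forall>q\<in>Q. dot n (R q) y mod p = w q then of_nat p ^ card Q else 0)" for y
  proof -
    have "(\<Sum>c\<in>?C. ?\<omega> ^ (\<Sum>q\<in>Q. c q * a q y)) = (\<Sum>c\<in>?C. \<Prod>q\<in>Q. ?\<omega> ^ (c q * a q y))"
      by (simp add: power_sum)
    also have "\<dots> = (\<Prod>q\<in>Q. \<Sum>t<p. ?\<omega> ^ (t * a q y))"
      using Q by (subst prod_sum_PiE) auto
    also have "\<dots> = (\<Prod>q\<in>Q. if p dvd a q y then of_nat p else 0)"
      by (simp add: sum_root1[OF p])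
    also have "\<dots> = (\<Prod>q\<in>Q. if dot n (R q) y mod p = w q then of_nat p else 0)"
      by (intro prod.cong) (auto simp: dvd)
    also have "\<dots> = (if \<forall>q\<in>Q. dot n (R q) y mod p = w q then of_nat p ^ card Q else 0)"
      using Q by (auto simp: prod_zero_iff)
    finally show ?thesis .
  qed
  have char: "(\<Sum>y\<in>Fpn p n. ?\<omega> ^ (\<Sum>q\<in>Q. c q * a q y))
      = (if \<forall>q\<in>Q. c q = 0 then of_nat p ^ n else 0)" if c: "c \<in> ?C" for c
  proof -
    let ?v = "\<lambda>i. \<Sum>q\<in>Q. c q * R q i"
    let ?k = "\<Sum>q\<in>Q. c q * (p - w q)"
    have "(\<Sum>q\<in>Q. c q * a q y) = (\<Sum>i<n. y i * ?v i) + ?k" for y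
    proof -
      have "(\<Sum>q\<in>Q. c q * a q y) = (\<Sum>q\<in>Q. \<Sum>i<n. c q * (R q i * y i)) + ?k"
        unfolding a_def dot_def by (simp add: distrib_left sum.distrib sum_distrib_left)
      also have "(\<Sum>q\<in>Q. \<Sum>i<n. c q * (R q i * y i)) = (\<Sum>i<n. y i * ?v i)"
        by (subst sum.swap) (simp add: sum_distrib_left algebra_simps)
      finally show ?thesis .
    qed
    then have "(\<Sum>y\<in>Fpn p n. ?\<omega> ^ (\<Sum>q\<in>Q. c q * a q y))
        = (\<Sum>y\<in>Fpn p n. \<Prod>i<n. ?\<omega> ^ (y i * ?v i)) * ?\<omega> ^ ?k"
      by (simp add: power_add power_sum sum_distrib_right)
    also have "(\<Sum>y\<in>Fpn p n. \<Prod>i<n. ?\<omega> ^ (y i * ?v i)) = (\<Prod>i<n. if p dvd ?v i then of_nat p else 0)"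
      by (subst sum_Fpn_prod) (simp only: sum_root1[OF p])
    finally have eq: "(\<Sum>y\<in>Fpn p n. ?\<omega> ^ (\<Sum>q\<in>Q. c q * a q y))
        = (\<Prod>i<n. if p dvd ?v i then of_nat p else 0) * ?\<omega> ^ ?k" .
    show ?thesis
    proof (cases "\<forall>q\<in>Q. c q = 0")
      case True
      then show ?thesis unfolding eq by simp
    next
      case False
      then obtain i where "i < n" "\<not> p dvd ?v i"
        using ind c unfolding indep_def by blast
      then have "(\<Prod>i<n. if p dvd ?v i then of_nat p else (0::complex)) = 0"
        by (auto simp: prod_zero_iff)
      then show ?thesis unfolding eq using False by simp
    qed
  qed
  define c0 where "c0 = restrict (\<lambda>_. 0::nat) Q"
  have c0: "c0 \<in> ?C" "\<And>c. c \<in> ?C \<Longrightarrow> (\<forall>q\<in>Q. c q = 0) \<longleftrightarrow> c = c0"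
    using p by (auto simp: c0_def PiE_def extensional_def fun_eq_iff restrict_def)
  have "of_nat (card {y \<in> Fpn p n. \<forall>q\<in>Q. dot n (R q) y mod p = w q} * p ^ card Q)
      = (\<Sum>y\<in>Fpn p n. if \<forall>q\<in>Q. dot n (R q) y mod p = w q then of_nat p ^ card Q else (0::complex))"
    by (simp add: sum.If_cases Int_def)
  also have "\<dots> = (\<Sum>y\<in>Fpn p n. \<Sum>c\<in>?C. ?\<omega> ^ (\<Sum>q\<in>Q. c q * a q y))"
    by (simp only: ind_eq)
  also have "\<dots> = (\<Sum>c\<in>?C. \<Sum>y\<in>Fpn p n. ?\<omega> ^ (\<Sum>q\<in>Q. c q * a q y))"
    by (rule sum.swap)
  also have "\<dots> = (\<Sum>c\<in>?C. if c = c0 then of_nat p ^ n else 0)"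
    by (intro sum.cong) (auto simp: char c0)
  also have "\<dots> = of_nat (p ^ n)"
    using fin c0(1) by simp
  finally show ?thesis by (simp only: of_nat_eq_iff)
qed

section \<open>Random families of matrices\<close>

lemma binomial_mult_fact_le: "(n choose k) * fact k \<le> (n::nat) ^ k"
proof (induction k arbitrary: n)
  case (Suc k)
  show ?case
  proof (cases n)
    case (Suc m)
    have "(Suc m choose Suc k) * fact (Suc k) = Suc k * (Suc m choose Suc k) * fact k"
      by (simp add: algebra_simps)
    also have "\<dots> = Suc m * ((m choose k) * fact k)"
      by (simp only: Suc_times_binomial mult.assoc)
    also have "\<dots> \<le> Suc m * m ^ k" using Suc.IH[of m] by (rule mult_left_mono) simp
    also have "\<dots> \<le> Suc m * Suc m ^ k" by (intro mult_left_mono power_mono) simp_all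
    finally show ?thesis using Suc by simp
  qed simp
qed simp

lemma power_self_le_fact: "real n ^ n \<le> 3 ^ n * fact n"
proof (induction n)
  case (Suc n)
  show ?case
  proof (cases "n = 0")
    case False
    have "(1 + 1 / real n) ^ n \<le> exp 1"
      using exp_ge_one_plus_x_over_n_power_n[of n 1] False by simp
    also have "\<dots> \<le> 3" by (rule exp_le)
    finally have "(1 + 1 / real n) ^ n * real n ^ n \<le> 3 * real n ^ n"
      by (rule mult_right_mono) simp
    moreover have "(1 + 1 / real n) ^ n * real n ^ n = real (Suc n) ^ n"
      using False by (simp add: power_mult_distrib[symmetric] field_simps)
    ultimately have "real (Suc n) ^ n \<le> 3 * real n ^ n" by simp
    also have "\<dots> \<le> 3 * (3 ^ n * fact n)" using Suc.IH by simp
    finally have "real (Suc n) * real (Suc n) ^ n \<le> real (Suc n) * (3 * (3 ^ n * fact n))"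
      by (rule mult_left_mono) simp
    then show ?thesis by (simp add: algebra_simps)
  qed simp
qed simp

text \<open>The binomial is at most N^n / n!, and n! is at least (n/3)^n, with 3 standing in for
  e.\<close>

lemma binomial_le_power:
  assumes "n > 0" shows "real (N choose n) \<le> (3 * real N / real n) ^ n"
proof -
  have "real (N choose n) * fact n \<le> real N ^ n"
    using binomial_mult_fact_le[of N n] by (metis of_nat_fact of_nat_le_iff of_nat_mult of_nat_power)
  then have "real (N choose n) * (real n ^ n) \<le> 3 ^ n * real N ^ n"
  proof -
    assume a: "real (N choose n) * fact n \<le> real N ^ n"
    have "real (N choose n) * real n ^ n \<le> real (N choose n) * (3 ^ n * fact n)"
      by (intro mult_left_mono power_self_le_fact) simp
    also have "\<dots> = 3 ^ n * (real (N choose n) * fact n)" by simp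
    also have "\<dots> \<le> 3 ^ n * real N ^ n" using a by (intro mult_left_mono) simp_all
    finally show ?thesis .
  qed
  then show ?thesis using assms by (simp add: power_divide power_mult_distrib field_simps)
qed

text \<open>Since \<open>c q0\<close> is invertible mod \<open>p\<close>, the relation determines
  row \<open>q0\<close> from the others. Forgetting that row is thus injective on the event, whose
  proportion is at most p^(-n).\<close>

lemma dependent_count:
  fixes Q :: "'q set"
  assumes p: "prime p" and Q: "finite Q" "Q0 \<subseteq> Q" and q0: "q0 \<in> Q0" "c q0 < p" "c q0 \<noteq> 0"
  shows "card {W \<in> PiE Q (\<lambda>_. Fpn p n). \<forall>i<n. p dvd (\<Sum>q\<in>Q0. c q * W q i)} * p ^ n
    \<le> card (PiE Q (\<lambda>_. Fpn p n))"
proof -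
  let ?B = "{W \<in> PiE Q (\<lambda>_. Fpn p n). \<forall>i<n. p dvd (\<Sum>q\<in>Q0. c q * W q i)}"
  let ?r = "\<lambda>W. restrict W (Q - {q0})"
  have "inj_on ?r ?B"
  proof (rule inj_onI)
    fix W W' assume W: "W \<in> ?B" and W': "W' \<in> ?B" and eq: "?r W = ?r W'"
    have same: "W q = W' q" if "q \<in> Q" "q \<noteq> q0" for q
      using fun_cong[OF eq, of q] that by simp
    have "W q0 i = W' q0 i" for i
    proof (cases "i < n")
      case True
      let ?s = "\<Sum>q\<in>Q0 - {q0}. c q * W q i"
      have fin: "finite Q0" using Q finite_subset by blast
      have split: "(\<Sum>q\<in>Q0. c q * V q i) = c q0 * V q0 i + (\<Sum>q\<in>Q0 - {q0}. c q * V q i)" for V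
        by (rule sum.remove[OF fin q0(1)])
      have "p dvd c q0 * W q0 i + ?s" "p dvd c q0 * W' q0 i + (\<Sum>q\<in>Q0 - {q0}. c q * W' q i)"
        using W W' True by (simp_all only: mem_Collect_eq split[symmetric])
      moreover have "(\<Sum>q\<in>Q0 - {q0}. c q * W' q i) = ?s"
        using same Q by (intro sum.cong) auto
      ultimately have "int p dvd int (c q0 * W q0 i + ?s) - int (c q0 * W' q0 i + ?s)"
        by (intro dvd_diff) (simp_all only: int_dvd_int_iff)
      then have "int p dvd int (c q0) * (int (W q0 i) - int (W' q0 i))"
        by (simp add: right_diff_distrib)
      moreover have "\<not> int p dvd int (c q0)" using q0 by (simp add: nat_dvd_not_less)
      ultimately have d: "int p dvd int (W q0 i) - int (W' q0 i)"
        using p by (simp add: prime_dvd_mult_iff)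
      have "W q0 i < p" "W' q0 i < p"
        using W W' q0(1) Q(2) True by (auto simp: PiE_iff Fpn_def)
      moreover have "int (W q0 i) mod int p = int (W' q0 i) mod int p"
        using d by (simp only: mod_eq_dvd_iff)
      ultimately show ?thesis by (simp flip: zmod_int)
    next
      case False
      have "W q0 \<in> Fpn p n" "W' q0 \<in> Fpn p n" using W W' q0(1) Q(2) by auto
      then show ?thesis using False by (simp add: Fpn_def)
    qed
    then have "W q0 = W' q0" by blast
    then have "W q = W' q" if "q \<in> Q" for q using same that by (cases "q = q0") auto
    then show "W = W'" using W W' by (intro PiE_ext[of W Q _ W']) auto
  qed
  moreover have "?r ` ?B \<subseteq> PiE (Q - {q0}) (\<lambda>_. Fpn p n)"
    by (intro image_subsetI) (simp add: PiE_iff)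
  ultimately have "card ?B \<le> card (PiE (Q - {q0}) (\<lambda>_. Fpn p n))"
    using Q by (intro card_inj_on_le[where f = ?r]) (auto intro!: finite_PiE)
  then have "card ?B * p ^ n \<le> card (PiE (Q - {q0}) (\<lambda>_. Fpn p n)) * p ^ n" by simp
  also have "\<dots> = card (PiE Q (\<lambda>_. Fpn p n))"
  proof -
    have "q0 \<in> Q" using q0 Q by blast
    then have "card Q = Suc (card (Q - {q0}))" by (rule card.remove[OF Q(1)])
    then show ?thesis using Q(1) by (simp add: card_PiE)
  qed
  finally show ?thesis .
qed

text \<open>A single independent condition, with the roles of vector and linear form exchanged:
  \<open>e\<close> is the only row and \<open>a\<close> the unknown.\<close>

lemma hyperplane_card:
  assumes p: "prime p" and e: "e \<in> Fpn p n" "e \<noteq> (\<lambda>_. 0)"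
  shows "card {a \<in> Fpn p n. p dvd dot n a e} * p = p ^ n"
proof -
  obtain i where i: "e i \<noteq> 0" using e by auto
  then have "i < n" using e(1) by (auto simp: Fpn_def intro: leI)
  then have "e i < p" using e(1) by (simp add: Fpn_def)
  then have nd: "\<not> p dvd e i" using i by (auto dest: dvd_imp_le)
  have "indep p n (\<lambda>_. e) {()}"
    unfolding indep_def
  proof (intro ballI impI)
    fix c :: "unit \<Rightarrow> nat" and q
    assume c: "c \<in> {()} \<rightarrow>\<^sub>E {..<p}" and a: "\<forall>i<n. p dvd (\<Sum>q\<in>{()}. c q * e i)"
    then have "p dvd c () * e i" using \<open>i < n\<close> by simp
    then have "p dvd c ()" using nd p by (simp add: prime_dvd_mult_iff)
    moreover have "c () < p" using c by auto
    ultimately show "c q = 0" by (cases q) (auto dest: dvd_imp_le)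
  qed
  from indep_fibre_card[OF _ _ this, of "\<lambda>_. 0"] p
  have "card {y \<in> Fpn p n. dot n e y mod p = 0} * p = p ^ n"
    by (simp add: prime_gt_0_nat)
  moreover have "dot n e y = dot n y e" for y
    by (simp add: dot_def mult.commute)
  ultimately show ?thesis by (simp add: dvd_eq_mod_eq_0)
qed

text \<open>The event is a box: each of the s |X| rows concerned is confined to the hyperplane
  orthogonal to \<open>e\<close>, the other rows are free.\<close>

lemma annihilator_count:
  fixes S :: "'x set"
  assumes p: "prime p" and S: "finite S" "X \<subseteq> S" and e: "e \<in> Fpn p n" "e \<noteq> (\<lambda>_. 0)"
  shows "card {W \<in> PiE (S \<times> {..<s}) (\<lambda>_. Fpn p n). \<forall>x\<in>X. \<forall>j<s. p dvd dot n (W (x, j)) e} * p ^ (s * card X)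
    = card (PiE (S \<times> {..<s}) (\<lambda>_. Fpn p n))"
proof -
  let ?K = "{a \<in> Fpn p n. p dvd dot n a e}"
  let ?A = "\<lambda>q. if q \<in> X \<times> {..<s} then ?K else Fpn p n"
  have eqA: "{W \<in> PiE (S \<times> {..<s}) (\<lambda>_. Fpn p n). \<forall>x\<in>X. \<forall>j<s. p dvd dot n (W (x, j)) e}
      = PiE (S \<times> {..<s}) ?A"
  proof (intro equalityI subsetI)
    fix W assume W: "W \<in> {W \<in> PiE (S \<times> {..<s}) (\<lambda>_. Fpn p n). \<forall>x\<in>X. \<forall>j<s. p dvd dot n (W (x, j)) e}"
    then show "W \<in> PiE (S \<times> {..<s}) ?A" by (intro PiE_I) auto
  next
    fix W assume W: "W \<in> PiE (S \<times> {..<s}) ?A"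
    have "W q \<in> Fpn p n" if "q \<in> S \<times> {..<s}" for q
      using PiE_mem[OF W that] by (simp split: if_splits)
    moreover have "p dvd dot n (W (x, j)) e" if "x \<in> X" "j < s" for x j
      using PiE_mem[OF W, of "(x, j)"] that S by auto
    ultimately show "W \<in> {W \<in> PiE (S \<times> {..<s}) (\<lambda>_. Fpn p n). \<forall>x\<in>X. \<forall>j<s. p dvd dot n (W (x, j)) e}"
      using W by (auto simp: PiE_def)
  qed
  have cA: "card (PiE (S \<times> {..<s}) ?A) = card ?K ^ card (X \<times> {..<s})
      * (p ^ n) ^ card (S \<times> {..<s} - X \<times> {..<s})"
  proof -
    have X: "X \<times> {..<s} \<subseteq> S \<times> {..<s}" "finite (S \<times> {..<s})" using S by auto
    have "card (PiE (S \<times> {..<s}) ?A) = (\<Prod>q\<in>S \<times> {..<s}. card (?A q))"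
      using S by (simp add: card_PiE)
    also have "\<dots> = (\<Prod>q\<in>S \<times> {..<s} - X \<times> {..<s}. card (?A q)) * (\<Prod>q\<in>X \<times> {..<s}. card (?A q))"
      by (rule prod.subset_diff[OF X])
    also have "(\<Prod>q\<in>X \<times> {..<s}. card (?A q)) = (\<Prod>q\<in>X \<times> {..<s}. card ?K)"
      by (intro prod.cong) auto
    also have "(\<Prod>q\<in>S \<times> {..<s} - X \<times> {..<s}. card (?A q)) = (\<Prod>q\<in>S \<times> {..<s} - X \<times> {..<s}. p ^ n)"
      by (intro prod.cong) auto
    finally show ?thesis by simp
  qed
  have cK: "card ?K ^ card (X \<times> {..<s}) * p ^ (s * card X) = (p ^ n) ^ card (X \<times> {..<s})"
  proof -
    have "card ?K ^ card (X \<times> {..<s}) * p ^ (s * card X) = (card ?K * p) ^ (s * card X)"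
      by (simp add: power_mult_distrib mult.commute card_cartesian_product)
    then show ?thesis unfolding hyperplane_card[OF p e] by (simp add: mult.commute card_cartesian_product)
  qed
  have total: "card (S \<times> {..<s}) = card (X \<times> {..<s}) + card (S \<times> {..<s} - X \<times> {..<s})"
  proof -
    have "finite (X \<times> {..<s})" "X \<times> {..<s} \<subseteq> S \<times> {..<s}" using S finite_subset by auto
    then show ?thesis using S card_mono[of "S \<times> {..<s}" "X \<times> {..<s}"]
      by (simp only: card_Diff_subset finite_cartesian_product finite_lessThan le_add_diff_inverse)
  qed
  have "card (PiE (S \<times> {..<s}) (\<lambda>_. Fpn p n)) = (p ^ n) ^ card (S \<times> {..<s})"
    using S by (simp add: card_PiE)
  then have "card (PiE (S \<times> {..<s}) (\<lambda>_. Fpn p n))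
      = (card ?K ^ card (X \<times> {..<s}) * p ^ (s * card X)) * (p ^ n) ^ card (S \<times> {..<s} - X \<times> {..<s})"
    by (simp only: total power_add cK)
  then show ?thesis by (simp only: eqA cA mult_ac)
qed

lemma many_zeros_count:
  fixes S :: "'x set"
  assumes p: "prime p" and S: "finite S" and e: "e \<in> Fpn p n" "e \<noteq> (\<lambda>_. 0)"
  shows "card {W \<in> PiE (S \<times> {..<s}) (\<lambda>_. Fpn p n). t \<le> card {x \<in> S. \<forall>j<s. p dvd dot n (W (x, j)) e}} * p ^ (s * t)
    \<le> (card S choose t) * card (PiE (S \<times> {..<s}) (\<lambda>_. Fpn p n))"
proof -
  let ?\<Omega> = "PiE (S \<times> {..<s}) (\<lambda>_. Fpn p n)"
  let ?E = "\<lambda>X. {W \<in> ?\<Omega>. \<forall>x\<in>X. \<forall>j<s. p dvd dot n (W (x, j)) e}"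
  let ?XX = "{X. X \<subseteq> S \<and> card X = t}"
  have fin: "finite ?\<Omega>" using S by (intro finite_PiE) auto
  have finXX: "finite ?XX" using S by simp
  have "{W \<in> ?\<Omega>. t \<le> card {x \<in> S. \<forall>j<s. p dvd dot n (W (x, j)) e}} \<subseteq> (\<Union>X\<in>?XX. ?E X)"
  proof
    fix W assume W: "W \<in> {W \<in> ?\<Omega>. t \<le> card {x \<in> S. \<forall>j<s. p dvd dot n (W (x, j)) e}}"
    then obtain X where "X \<subseteq> {x \<in> S. \<forall>j<s. p dvd dot n (W (x, j)) e}" "card X = t"
      by (auto elim: obtain_subset_with_card_n)
    then show "W \<in> (\<Union>X\<in>?XX. ?E X)" using W by (intro UN_I[of X]) auto
  qed
  then have "card {W \<in> ?\<Omega>. t \<le> card {x \<in> S. \<forall>j<s. p dvd dot n (W (x, j)) e}} \<le> card (\<Union>X\<in>?XX. ?E X)"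
    using fin finXX by (intro card_mono) auto
  also have "\<dots> \<le> (\<Sum>X\<in>?XX. card (?E X))" using finXX by (rule card_UN_le)
  finally have "card {W \<in> ?\<Omega>. t \<le> card {x \<in> S. \<forall>j<s. p dvd dot n (W (x, j)) e}} * p ^ (s * t)
      \<le> (\<Sum>X\<in>?XX. card (?E X)) * p ^ (s * t)" by simp
  also have "\<dots> = (\<Sum>X\<in>?XX. card (?E X) * p ^ (s * card X))"
    by (simp add: sum_distrib_right)
  also have "\<dots> = (\<Sum>X\<in>?XX. card ?\<Omega>)"
    by (intro sum.cong refl annihilator_count[OF p S(1) _ e]) auto
  also have "\<dots> = (card S choose t) * card ?\<Omega>"
    using S by (simp add: n_subsets)
  finally show ?thesis .
qed

text \<open>Two union bounds. There are at most |S|^3 p^(3s) nontrivial relations among three maps,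
  each of probability at most p^(-n), so by \<open>c2\<close> dependence has probability at most
  1/2. For fixed \<open>e\<close>, at least \<open>n\<close> maps kill it with probability at most
  (|S| choose n) p^(-sn), which is at most p^(-2n) by \<open>c1\<close>; the p^n choices of
  \<open>e\<close> then contribute at most p^(-n) < 1/2. Since {x, y, z} is a set, coinciding
  indices are covered and single maps are included.\<close>

lemma random_matrices:
  fixes S :: "'x set"
  assumes p: "prime p" "p \<ge> 3" and S: "finite S" and n: "n > 0"
    and c1: "3 * p ^ 2 * card S \<le> n * p ^ s" and c2: "2 * card S ^ 3 * p ^ (3 * s) \<le> p ^ n"
  obtains W :: "'x \<times> nat \<Rightarrow> nat \<Rightarrow> nat"
  where "\<And>x y z. \<lbrakk>x \<in> S; y \<in> S; z \<in> S\<rbrakk> \<Longrightarrow> indep p n W ({x, y, z} \<times> {..<s})"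
    and "\<And>e. \<lbrakk>e \<in> Fpn p n; e \<noteq> (\<lambda>_. 0)\<rbrakk> \<Longrightarrow> card {x \<in> S. \<forall>j<s. p dvd dot n (W (x, j)) e} < n"
proof -
  let ?\<Omega> = "PiE (S \<times> {..<s}) (\<lambda>_. Fpn p n)"
  let ?T = "S \<times> S \<times> S"
  define Q where "Q = (\<lambda>(x :: 'x, y :: 'x, z :: 'x). {x, y, z} \<times> {..<s})"
  define C where "C = (\<lambda>t. {c \<in> PiE (Q t) (\<lambda>_. {..<p}). \<not> (\<forall>q\<in>Q t. c q = 0)})"
  let ?D = "\<lambda>(t, c). {W \<in> ?\<Omega>. \<forall>i<n. p dvd (\<Sum>q\<in>Q t. c q * W q i)}"
  let ?Z = "\<lambda>e. {W \<in> ?\<Omega>. n \<le> card {x \<in> S. \<forall>j<s. p dvd dot n (W (x, j)) e}}"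
  let ?E = "Fpn p n - {\<lambda>_. 0}"
  have p0: "p > 0" using p by simp
  have fin: "finite ?\<Omega>" using S by (intro finite_PiE) auto
  have pos: "card ?\<Omega> > 0" using S p0 by (simp add: card_PiE)
  have finC: "finite (C t)" for t
    by (rule finite_subset[of _ "PiE (Q t) (\<lambda>_. {..<p})"]) (auto intro!: finite_PiE simp: C_def Q_def split: prod.splits)
  have finT: "finite (Sigma ?T C)" using S finC by (intro finite_SigmaI) auto
  have cardC: "card (C t) \<le> p ^ (3 * s)" for t
  proof -
    obtain x y z where t: "t = (x, y, z)" by (cases t) auto
    have "card (C t) \<le> card (PiE (Q t) (\<lambda>_. {..<p}))"
      by (rule card_mono) (auto intro!: finite_PiE simp: C_def Q_def split: prod.splits)
    also have "\<dots> = p ^ (card {x, y, z} * s)"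
      by (simp add: t Q_def card_PiE card_cartesian_product)
    also have "\<dots> \<le> p ^ (3 * s)"
      using p0 by (intro power_increasing mult_right_mono) (auto simp: card_insert_if)
    finally show ?thesis .
  qed
  have "card (Sigma ?T C) = (\<Sum>t\<in>?T. card (C t))"
    using S finC by (intro card_SigmaI) auto
  also have "\<dots> \<le> (\<Sum>t\<in>?T. p ^ (3 * s))" by (intro sum_mono cardC)
  also have "\<dots> = card S ^ 3 * p ^ (3 * s)"
    by (simp add: card_cartesian_product power3_eq_cube mult.assoc)
  finally have cardSig: "card (Sigma ?T C) \<le> card S ^ 3 * p ^ (3 * s)" .
  have D: "card (?D u) * p ^ n \<le> card ?\<Omega>" if "u \<in> Sigma ?T C" for u
  proof -
    obtain t c where u: "u = (t, c)" by (cases u)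
    have t: "t \<in> ?T" and c: "c \<in> C t" using that u by simp_all
    obtain q0 where q0: "q0 \<in> Q t" "c q0 \<noteq> 0" using c unfolding C_def by blast
    moreover have "c q0 < p" using c q0 by (auto simp: C_def PiE_iff)
    moreover have "Q t \<subseteq> S \<times> {..<s}" using t by (auto simp: Q_def)
    ultimately have "card {W \<in> ?\<Omega>. \<forall>i<n. p dvd (\<Sum>q\<in>Q t. c q * W q i)} * p ^ n \<le> card ?\<Omega>"
      using S by (intro dependent_count[OF p(1)]) auto
    then show ?thesis using u by simp
  qed
  have "card (\<Union>u\<in>Sigma ?T C. ?D u) * p ^ n \<le> (\<Sum>u\<in>Sigma ?T C. card (?D u)) * p ^ n"
    using card_UN_le[OF finT, of ?D] by (rule mult_right_mono) simp
  also have "\<dots> = (\<Sum>u\<in>Sigma ?T C. card (?D u) * p ^ n)" by (rule sum_distrib_right)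
  also have "\<dots> \<le> (\<Sum>u\<in>Sigma ?T C. card ?\<Omega>)" by (intro sum_mono D)
  also have "\<dots> = card (Sigma ?T C) * card ?\<Omega>" by simp
  also have "\<dots> \<le> (card S ^ 3 * p ^ (3 * s)) * card ?\<Omega>" using cardSig by (rule mult_right_mono) simp
  finally have "2 * (card (\<Union>u\<in>Sigma ?T C. ?D u) * p ^ n) \<le> (2 * card S ^ 3 * p ^ (3 * s)) * card ?\<Omega>"
    by simp
  also have "\<dots> \<le> p ^ n * card ?\<Omega>" using c2 by (rule mult_right_mono) simp
  finally have bad1: "2 * card (\<Union>u\<in>Sigma ?T C. ?D u) \<le> card ?\<Omega>"
    using p0 by (simp add: mult.commute mult.left_commute)
  have Z: "real (card (?Z e)) \<le> real (card ?\<Omega>) / real p ^ (2 * n)" if "e \<in> ?E" for e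
  proof -
    have "3 * real (card S) / real n \<le> real p ^ s / real p ^ 2"
    proof -
      have "3 * real p ^ 2 * real (card S) \<le> real n * real p ^ s"
        using c1 by (metis (mono_tags) of_nat_le_iff of_nat_mult of_nat_numeral of_nat_power)
      then show ?thesis using n p0 by (simp add: field_simps)
    qed
    then have "(3 * real (card S) / real n) ^ n \<le> (real p ^ s / real p ^ 2) ^ n"
      by (rule power_mono) simp
    then have b: "real (card S choose n) \<le> real p ^ (s * n) / real p ^ (2 * n)"
      using binomial_le_power[OF n, of "card S"] by (simp add: power_divide power_mult)
    have "real (card (?Z e)) * real p ^ (s * n) \<le> real (card S choose n) * real (card ?\<Omega>)"
      using many_zeros_count[OF p(1) S, of e n s n] that
      by (metis (no_types, lifting) DiffE insert_iff of_nat_le_iff of_nat_mult of_nat_power)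
    also have "\<dots> \<le> real p ^ (s * n) / real p ^ (2 * n) * real (card ?\<Omega>)"
      using b by (rule mult_right_mono) simp
    finally show ?thesis using p0 by (simp add: field_simps)
  qed
  have "real (card (\<Union>e\<in>?E. ?Z e)) \<le> (\<Sum>e\<in>?E. real (card (?Z e)))"
    using card_UN_le[of ?E ?Z] by (simp flip: of_nat_sum)
  also have "\<dots> \<le> (\<Sum>e\<in>?E. real (card ?\<Omega>) / real p ^ (2 * n))" by (intro sum_mono Z)
  also have "\<dots> = real (card ?E) * (real (card ?\<Omega>) / real p ^ (2 * n))" by simp
  also have "\<dots> \<le> real p ^ n * (real (card ?\<Omega>) / real p ^ (2 * n))"
  proof (rule mult_right_mono)
    have "card ?E \<le> card (Fpn p n)" by (rule card_mono) auto
    then show "real (card ?E) \<le> real p ^ n" by (simp flip: of_nat_power)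
  qed simp
  also have "\<dots> = real (card ?\<Omega>) / real p ^ n" using p0 by (simp add: mult_2 power_add)
  also have "\<dots> < real (card ?\<Omega>) / 2"
  proof -
    have "real p ^ 1 \<le> real p ^ n" using n p by (intro power_increasing) auto
    moreover have "3 \<le> real p" using p by simp
    ultimately have "2 < real p ^ n" unfolding power_one_right by linarith
    then show ?thesis using pos p0 by (intro divide_strict_left_mono) auto
  qed
  finally have bad2: "2 * card (\<Union>e\<in>?E. ?Z e) < card ?\<Omega>" by linarith
  let ?B = "(\<Union>u\<in>Sigma ?T C. ?D u) \<union> (\<Union>e\<in>?E. ?Z e)"
  have "card ?B \<le> card (\<Union>u\<in>Sigma ?T C. ?D u) + card (\<Union>e\<in>?E. ?Z e)" by (rule card_Un_le)
  then have "card ?B < card ?\<Omega>" using bad1 bad2 by linarith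
  then have "\<not> ?\<Omega> \<subseteq> ?B"
    using fin card_mono[of ?B ?\<Omega>] finT by (auto simp: finite_subset[OF _ fin] split: prod.splits)
  then obtain W where W: "W \<in> ?\<Omega>" "W \<notin> ?B" by blast
  show ?thesis
  proof (rule that[of W])
    fix x y z assume xyz: "x \<in> S" "y \<in> S" "z \<in> S"
    show "indep p n W ({x, y, z} \<times> {..<s})"
      unfolding indep_def
    proof (intro ballI impI, rule ccontr)
      fix c q assume c: "c \<in> {x, y, z} \<times> {..<s} \<rightarrow>\<^sub>E {..<p}"
        and d: "\<forall>i<n. p dvd (\<Sum>q\<in>{x, y, z} \<times> {..<s}. c q * W q i)"
        and q: "q \<in> {x, y, z} \<times> {..<s}" "c q \<noteq> 0"
      then have "((x, y, z), c) \<in> Sigma ?T C" using xyz by (auto simp: C_def Q_def)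
      moreover have "W \<in> ?D ((x, y, z), c)" using W(1) d by (simp add: Q_def)
      ultimately show False using W(2) by blast
    qed
  next
    fix e assume "e \<in> Fpn p n" "e \<noteq> (\<lambda>_. 0)"
    then have "W \<notin> ?Z e" using W(2) by blast
    then show "card {x \<in> S. \<forall>j<s. p dvd dot n (W (x, j)) e} < n" using W(1) by auto
  qed
qed

section \<open>The iteration step\<close>

definition matvec :: "nat \<Rightarrow> nat \<Rightarrow> nat \<Rightarrow> ('x \<times> nat \<Rightarrow> nat \<Rightarrow> nat) \<Rightarrow> 'x \<Rightarrow> (nat \<Rightarrow> nat) \<Rightarrow> nat \<Rightarrow> nat" where
  "matvec p n s W x y = (\<lambda>j. if j < s then dot n (W (x, j)) y mod p else 0)"

lemma matvec_in_Fpn: "p > 0 \<Longrightarrow> matvec p n s W x y \<in> Fpn p s"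
  by (simp add: matvec_def Fpn_def)

lemma vadd_in_Fpn: "p > 0 \<Longrightarrow> x \<in> Fpn p n \<Longrightarrow> y \<in> Fpn p n \<Longrightarrow> vadd p x y \<in> Fpn p n"
  by (simp add: vadd_def Fpn_def)

lemma vadd_apply: "vadd p x y i = (x i + y i) mod p"
  by (simp add: vadd_def)

lemma vadd_zero: "x \<in> Fpn p n \<Longrightarrow> vadd p x (\<lambda>_. 0) = x"
  by (auto simp: vadd_def Fpn_def fun_eq_iff) (metis gr_implies_not0 mod_0 mod_less not_le)

lemma dot_vadd: "dot n a (vadd p x y) mod p = (dot n a x + dot n a y) mod p"
proof -
  have "dot n a (vadd p x y) mod p = (\<Sum>i<n. (a i * ((x i + y i) mod p)) mod p) mod p"
    unfolding dot_def vadd_def by (rule mod_sum_eq[symmetric])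
  also have "\<dots> = (\<Sum>i<n. (a i * (x i + y i)) mod p) mod p"
    by (simp only: mod_mult_right_eq)
  also have "\<dots> = (\<Sum>i<n. a i * (x i + y i)) mod p" by (rule mod_sum_eq)
  also have "\<dots> = (dot n a x + dot n a y) mod p"
    unfolding dot_def by (simp only: distrib_left sum.distrib)
  finally show ?thesis .
qed

lemma matvec_vadd:
  "matvec p n s W x (vadd p y e) = vadd p (matvec p n s W x y) (matvec p n s W x e)"
proof
  fix j
  show "matvec p n s W x (vadd p y e) j = vadd p (matvec p n s W x y) (matvec p n s W x e) j"
    by (simp add: matvec_def vadd_apply dot_vadd mod_add_eq)
qed

lemma inj_on_vadd: "inj_on (\<lambda>t. vadd p t c) (Fpn p n)"
proof (rule inj_onI)
  fix t t' assume t: "t \<in> Fpn p n" "t' \<in> Fpn p n" and eq: "vadd p t c = vadd p t' c"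
  show "t = t'"
  proof
    fix i
    show "t i = t' i"
    proof (cases "i < n")
      case True
      have "(t i + c i) mod p = (t' i + c i) mod p" using fun_cong[OF eq, of i] by (simp add: vadd_def)
      then have "int (t i + c i) mod int p = int (t' i + c i) mod int p" by (metis zmod_int)
      then have "int p dvd int (t i) - int (t' i)" by (simp add: mod_eq_dvd_iff)
      then have "int (t i) mod int p = int (t' i) mod int p" by (simp add: mod_eq_dvd_iff)
      moreover have "t i < p" "t' i < p" using t True by (auto simp: Fpn_def)
      ultimately show ?thesis by (simp flip: zmod_int)
    qed (use t in \<open>simp add: Fpn_def\<close>)
  qed
qed

lemma card_translate_le:
  assumes "T \<subseteq> Fpn p n"
  shows "card {t \<in> Fpn p n. vadd p t c \<in> T} \<le> card T"
proof -
  have "inj_on (\<lambda>t. vadd p t c) {t \<in> Fpn p n. vadd p t c \<in> T}"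
    using inj_on_vadd by (rule inj_on_subset) auto
  moreover have "(\<lambda>t. vadd p t c) ` {t \<in> Fpn p n. vadd p t c \<in> T} \<subseteq> T" by auto
  ultimately show ?thesis using assms by (meson card_inj_on_le finite_Fpn finite_subset)
qed

text \<open>Independence makes the tuple of values V_x y equidistributed. The target may vary with
  \<open>x\<close> because later points of a progression are tested against translates of one
  set.\<close>

lemma matvec_joint_count:
  fixes W :: "'x \<times> nat \<Rightarrow> nat \<Rightarrow> nat"
  assumes p: "p > 0" and X: "finite X" and ind: "indep p n W (X \<times> {..<s})"
    and T: "\<And>x. x \<in> X \<Longrightarrow> T x \<subseteq> Fpn p s"
  shows "card {y \<in> Fpn p n. \<forall>x\<in>X. matvec p n s W x y \<in> T x} * p ^ (s * card X)
    = (\<Prod>x\<in>X. card (T x)) * p ^ n"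
proof -
  let ?F = "\<lambda>t. {y \<in> Fpn p n. \<forall>x\<in>X. matvec p n s W x y = t x}"
  let ?P = "PiE X T"
  have finT: "finite (T x)" if "x \<in> X" for x using T[OF that] finite_subset finite_Fpn by blast
  have finP: "finite ?P" using X finT by (intro finite_PiE) auto
  have "{y \<in> Fpn p n. \<forall>x\<in>X. matvec p n s W x y \<in> T x} = (\<Union>t\<in>?P. ?F t)"
  proof (intro equalityI subsetI)
    fix y assume "y \<in> {y \<in> Fpn p n. \<forall>x\<in>X. matvec p n s W x y \<in> T x}"
    then show "y \<in> (\<Union>t\<in>?P. ?F t)"
      by (intro UN_I[of "restrict (\<lambda>x. matvec p n s W x y) X"]) auto
  next
    fix y assume "y \<in> (\<Union>t\<in>?P. ?F t)"
    then obtain t where "t \<in> ?P" "y \<in> ?F t" by blast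
    then show "y \<in> {y \<in> Fpn p n. \<forall>x\<in>X. matvec p n s W x y \<in> T x}" by (auto dest: PiE_mem)
  qed
  moreover have "card (\<Union>t\<in>?P. ?F t) = (\<Sum>t\<in>?P. card (?F t))"
  proof (rule card_UN_disjoint[OF finP])
    show "\<forall>t\<in>?P. \<forall>t'\<in>?P. t \<noteq> t' \<longrightarrow> ?F t \<inter> ?F t' = {}"
    proof (intro ballI impI)
      fix t t' assume t: "t \<in> ?P" "t' \<in> ?P" "t \<noteq> t'"
      then obtain x where "x \<in> X" "t x \<noteq> t' x" by (meson PiE_ext)
      then show "?F t \<inter> ?F t' = {}" by fastforce
    qed
  qed simp
  moreover have "card (?F t) * p ^ (s * card X) = p ^ n" if t: "t \<in> ?P" for t
  proof -
    have tF: "t x \<in> Fpn p s" if "x \<in> X" for x using PiE_mem[OF t that] T[OF that] by blast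
    have "(\<forall>x\<in>X. matvec p n s W x y = t x)
        \<longleftrightarrow> (\<forall>q\<in>X \<times> {..<s}. dot n (W q) y mod p = t (fst q) (snd q))" for y
    proof
      assume a: "\<forall>x\<in>X. matvec p n s W x y = t x"
      show "\<forall>q\<in>X \<times> {..<s}. dot n (W q) y mod p = t (fst q) (snd q)"
      proof
        fix q assume "q \<in> X \<times> {..<s}"
        then obtain x j where q: "q = (x, j)" "x \<in> X" "j < s" by auto
        then have "matvec p n s W x y j = t x j" using a by simp
        then show "dot n (W q) y mod p = t (fst q) (snd q)" using q by (simp add: matvec_def)
      qed
    next
      assume a: "\<forall>q\<in>X \<times> {..<s}. dot n (W q) y mod p = t (fst q) (snd q)"
      show "\<forall>x\<in>X. matvec p n s W x y = t x"
      proof (intro ballI ext)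
        fix x j assume x: "x \<in> X"
        show "matvec p n s W x y j = t x j"
          using bspec[OF a, of "(x, j)"] tF[OF x] x by (auto simp: matvec_def Fpn_def)
      qed
    qed
    then have "?F t = {y \<in> Fpn p n. \<forall>q\<in>X \<times> {..<s}. dot n (W q) y mod p = t (fst q) (snd q)}" by blast
    moreover have "card {y \<in> Fpn p n. \<forall>q\<in>X \<times> {..<s}. dot n (W q) y mod p = t (fst q) (snd q)}
        * p ^ card (X \<times> {..<s}) = p ^ n"
      using X tF by (intro indep_fibre_card[OF p _ ind]) (auto simp: Fpn_def)
    ultimately show ?thesis by (simp add: card_cartesian_product mult.commute)
  qed
  ultimately have "card {y \<in> Fpn p n. \<forall>x\<in>X. matvec p n s W x y \<in> T x} * p ^ (s * card X)
      = (\<Sum>t\<in>?P. p ^ n)"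
    by (simp add: sum_distrib_right)
  then show ?thesis using X by (simp add: card_PiE)
qed

section \<open>Splitting a vector into two blocks; progression-free and sparse sets\<close>

definition pr1 :: "nat \<Rightarrow> (nat \<Rightarrow> nat) \<Rightarrow> nat \<Rightarrow> nat" where
  "pr1 m z = (\<lambda>i. if i < m then z i else 0)"

definition pr2 :: "nat \<Rightarrow> (nat \<Rightarrow> nat) \<Rightarrow> nat \<Rightarrow> nat" where
  "pr2 m z = (\<lambda>i. z (i + m))"

lemma pr_vadd: "pr1 m (vadd p x y) = vadd p (pr1 m x) (pr1 m y)"
  "pr2 m (vadd p x y) = vadd p (pr2 m x) (pr2 m y)"
  by (auto simp: pr1_def pr2_def vadd_def)

lemma bij_betw_pr: "bij_betw (\<lambda>z. (pr1 m z, pr2 m z)) (Fpn p (m + n)) (Fpn p m \<times> Fpn p n)"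
  by (rule bij_betwI[where g = "\<lambda>(x, y) i. if i < m then x i else y (i - m)"])
    (auto simp: Fpn_def pr1_def pr2_def fun_eq_iff)

lemma card_pr:
  "card {z \<in> Fpn p (m + n). P (pr1 m z) (pr2 m z)} = (\<Sum>x\<in>Fpn p m. card {y \<in> Fpn p n. P x y})"
proof -
  let ?h = "\<lambda>z. (pr1 m z, pr2 m z)"
  have "bij_betw ?h {z \<in> Fpn p (m + n). P (pr1 m z) (pr2 m z)} (SIGMA x:Fpn p m. {y \<in> Fpn p n. P x y})"
  proof -
    have "?h ` {z \<in> Fpn p (m + n). P (pr1 m z) (pr2 m z)}
        = {u \<in> ?h ` Fpn p (m + n). P (fst u) (snd u)}" by auto
    also have "?h ` Fpn p (m + n) = Fpn p m \<times> Fpn p n" using bij_betw_pr by (rule bij_betw_imp_surj_on)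
    finally have "?h ` {z \<in> Fpn p (m + n). P (pr1 m z) (pr2 m z)} = (SIGMA x:Fpn p m. {y \<in> Fpn p n. P x y})"
      by auto
    moreover have "inj_on ?h {z \<in> Fpn p (m + n). P (pr1 m z) (pr2 m z)}"
      using bij_betw_imp_inj_on[OF bij_betw_pr] by (rule inj_on_subset) auto
    ultimately show ?thesis by (simp add: bij_betw_def)
  qed
  then have "card {z \<in> Fpn p (m + n). P (pr1 m z) (pr2 m z)} = card (SIGMA x:Fpn p m. {y \<in> Fpn p n. P x y})"
    by (rule bij_betw_same_card)
  then show ?thesis by simp
qed

definition apfree :: "nat \<Rightarrow> nat \<Rightarrow> (nat \<Rightarrow> nat) set \<Rightarrow> bool" where
  "apfree p s T \<longleftrightarrow> T \<subseteq> Fpn p s \<and> (\<forall>x\<in>T. \<forall>w\<in>Fpn p s.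
     vadd p x w \<in> T \<and> vadd p (vadd p x w) w \<in> T \<longrightarrow> w = (\<lambda>_. 0))"

definition sparse :: "nat \<Rightarrow> real \<Rightarrow> nat \<Rightarrow> real \<Rightarrow> bool" where
  "sparse p R m \<mu> \<longleftrightarrow> (\<exists>S\<subseteq>Fpn p m. density p m S = \<mu> \<and>
     (\<forall>d\<in>Fpn p m. d \<noteq> (\<lambda>_. 0) \<longrightarrow> ap3_density p m S d * R \<le> \<mu> ^ 3))"

text \<open>Three maps are jointly independent only if their indices differ; oddness of
  \<open>p\<close> is what separates the first point from the third.\<close>

lemma vadd_twice_distinct:
  assumes p: "prime p" "p \<ge> 3" and x: "x \<in> Fpn p m" and d: "d \<in> Fpn p m" "d \<noteq> (\<lambda>_. 0)"
  shows "x \<noteq> vadd p x d" "vadd p x d \<noteq> vadd p (vadd p x d) d" "x \<noteq> vadd p (vadd p x d) d"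
proof -
  obtain i where i: "d i \<noteq> 0" using d by auto
  then have im: "i < m" using d(1) by (auto simp: Fpn_def intro: leI)
  have lt: "x i < p" "d i < p" using im x d by (auto simp: Fpn_def)
  have A: "\<not> p dvd d i" using i lt by (simp add: nat_dvd_not_less)
  have B: "\<not> p dvd 2 * d i"
  proof
    assume "p dvd 2 * d i"
    then have "p dvd 2" using A p(1) by (simp add: prime_dvd_mult_iff)
    then show False using p(2) by (auto dest: dvd_imp_le)
  qed
  have key: "False" if "u < p" "(u + c) mod p = u" "\<not> p dvd c" for u c
  proof -
    have "(u + c) mod p = (u + 0) mod p" using that by simp
    then have "int p dvd int (u + c) - int u" by (metis mod_eq_dvd_iff zmod_int add_0_right)
    then show False using that(3) by simp
  qed
  show "x \<noteq> vadd p x d" using key[OF lt(1) _ A] by (metis vadd_def)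
  have "vadd p x d i < p" using lt by (simp add: vadd_def)
  then show "vadd p x d \<noteq> vadd p (vadd p x d) d"
    using key[OF _ _ A] by (metis vadd_def)
  have "vadd p (vadd p x d) d i = (x i + 2 * d i) mod p"
    by (simp add: vadd_def mod_add_left_eq mult_2 add.assoc)
  then show "x \<noteq> vadd p (vadd p x d) d" using key[OF lt(1) _ B] by metis
qed

text \<open>\<open>c1\<close> and \<open>c2\<close> are the lower and upper ends of the window for
  the new dimension: \<open>c1\<close> keeps the number of maps killing a vector below
  \<open>n\<close>, \<open>c2\<close> makes \<open>n\<close> such maps harmless. The linear bound on
  \<open>n\<close> leaves room for the union bound over dependent triples.\<close>

lemma sparse_step:
  assumes p: "prime p" "p \<ge> 3" and sp: "sparse p R m \<mu>" and T: "apfree p s T" and R: "R \<ge> 0"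
    and n: "3 * m + 3 * s + 1 \<le> n"
    and c1: "3 * real p ^ 2 * \<mu> * real p ^ m \<le> real n * real p ^ s"
    and c2: "real n * R \<le> \<mu> ^ 3 * density p s T ^ 2 * real p ^ m"
  shows "sparse p R (m + n) (\<mu> * density p s T)"
proof -
  obtain S where S: "S \<subseteq> Fpn p m" and \<mu>: "density p m S = \<mu>"
    and ap: "\<And>d. d \<in> Fpn p m \<Longrightarrow> d \<noteq> (\<lambda>_. 0) \<Longrightarrow> ap3_density p m S d * R \<le> \<mu> ^ 3"
    using sp unfolding sparse_def by blast
  have p0: "p > 0" using p by simp
  have finS: "finite S" using S finite_subset finite_Fpn by blast
  have TF: "T \<subseteq> Fpn p s" using T by (simp add: apfree_def)
  define \<tau> where "\<tau> = density p s T"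
  have cardS: "real (card S) = \<mu> * real p ^ m" using \<mu> p0 by (simp add: density_def field_simps)
  have cardT: "real (card T) = \<tau> * real p ^ s" using p0 by (simp add: \<tau>_def density_def)
  have \<tau>0: "\<tau> \<ge> 0" by (simp add: \<tau>_def density_def)
  have k1: "3 * p ^ 2 * card S \<le> n * p ^ s"
  proof -
    have "real (3 * p ^ 2 * card S) \<le> real (n * p ^ s)" using c1 cardS by simp
    then show ?thesis by linarith
  qed
  have k2: "2 * card S ^ 3 * p ^ (3 * s) \<le> p ^ n"
  proof -
    have "card S \<le> p ^ m" using card_mono[OF finite_Fpn S] by simp
    then have "card S ^ 3 \<le> (p ^ m) ^ 3" by (rule power_mono) simp
    \<comment> \<open>The factor 2 is absorbed by one power of \<open>p\<close>, the +1 in the bound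
      on \<open>n\<close>.\<close>
    then have "2 * card S ^ 3 * p ^ (3 * s) \<le> p * (p ^ m) ^ 3 * p ^ (3 * s)"
      using p by (intro mult_mono) auto
    also have "\<dots> = p ^ (3 * m + 3 * s + 1)" by (simp add: power_add power_mult mult.commute)
    also have "\<dots> \<le> p ^ n" using n p0 by (intro power_increasing) auto
    finally show ?thesis .
  qed
  have n0: "n > 0" using n by simp
  obtain W :: "(nat \<Rightarrow> nat) \<times> nat \<Rightarrow> nat \<Rightarrow> nat"
    where ind: "\<And>x y z. \<lbrakk>x \<in> S; y \<in> S; z \<in> S\<rbrakk> \<Longrightarrow> indep p n W ({x, y, z} \<times> {..<s})"
    and few: "\<And>e. \<lbrakk>e \<in> Fpn p n; e \<noteq> (\<lambda>_. 0)\<rbrakk> \<Longrightarrow> card {x \<in> S. \<forall>j<s. p dvd dot n (W (x, j)) e} < n"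
    by (rule random_matrices[OF p finS n0 k1 k2]) blast
  let ?V = "matvec p n s W"
  define A where "A = {z \<in> Fpn p (m + n). pr1 m z \<in> S \<and> ?V (pr1 m z) (pr2 m z) \<in> T}"
  have VF: "?V x y \<in> Fpn p s" for x y by (rule matvec_in_Fpn[OF p0])
  have fib1: "real (card {y \<in> Fpn p n. ?V x y \<in> T}) = \<tau> * real p ^ n" if "x \<in> S" for x
  proof -
    have i: "indep p n W ({x} \<times> {..<s})" using ind[OF that that that] by simp
    have "card {y \<in> Fpn p n. \<forall>x\<in>{x}. ?V x y \<in> T} * p ^ (s * card {x}) = (\<Prod>x\<in>{x}. card T) * p ^ n"
      by (rule matvec_joint_count[OF p0 _ i TF]) simp
    then have "card {y \<in> Fpn p n. ?V x y \<in> T} * p ^ s = card T * p ^ n" by simp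
    then have "real (card {y \<in> Fpn p n. ?V x y \<in> T}) * real p ^ s = real (card T) * real p ^ n"
      by (simp only: of_nat_eq_iff flip: of_nat_power of_nat_mult)
    then show ?thesis using p0 cardT by simp
  qed
  have fib3: "real (card {y \<in> Fpn p n. ?V x y \<in> T \<and> vadd p (?V x' y) a \<in> T \<and> vadd p (?V x'' y) b \<in> T})
      \<le> \<tau> ^ 3 * real p ^ n"
    if x: "x \<in> S" "x' \<in> S" "x'' \<in> S" "x \<noteq> x'" "x' \<noteq> x''" "x \<noteq> x''" for x x' x'' a b
  proof -
    \<comment> \<open>The shifts \<open>a\<close>, \<open>b\<close> do not depend on
      \<open>y\<close>, so each condition says that one map takes its value in a fixed translate of
      \<open>T\<close>, which is no larger than \<open>T\<close>.\<close>
    define U where "U = (\<lambda>u. if u = x then T else if u = x' then {t \<in> Fpn p s. vadd p t a \<in> T}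
       else {t \<in> Fpn p s. vadd p t b \<in> T})"
    have "card {y \<in> Fpn p n. \<forall>u\<in>{x, x', x''}. ?V u y \<in> U u} * p ^ (s * card {x, x', x''})
        = (\<Prod>u\<in>{x, x', x''}. card (U u)) * p ^ n"
      using TF by (intro matvec_joint_count[OF p0 _ ind]) (auto simp: x U_def)
    moreover have "{y \<in> Fpn p n. \<forall>u\<in>{x, x', x''}. ?V u y \<in> U u}
        = {y \<in> Fpn p n. ?V x y \<in> T \<and> vadd p (?V x' y) a \<in> T \<and> vadd p (?V x'' y) b \<in> T}"
      using x VF by (auto simp: U_def)
    moreover have "(\<Prod>u\<in>{x, x', x''}. card (U u)) = card (U x) * (card (U x') * card (U x''))"
      using x by simp
    moreover have "card (U u) \<le> card T" for u
      using card_translate_le[OF TF] by (simp add: U_def)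
    then have "card (U x) * (card (U x') * card (U x'')) \<le> card T * (card T * card T)"
      by (intro mult_mono) auto
    moreover have "card {x, x', x''} = 3" using x by simp
    ultimately have "card {y \<in> Fpn p n. ?V x y \<in> T \<and> vadd p (?V x' y) a \<in> T \<and> vadd p (?V x'' y) b \<in> T}
        * p ^ (s * 3) \<le> card T * (card T * card T) * p ^ n"
      by (metis mult_le_mono1)
    then have "real (card {y \<in> Fpn p n. ?V x y \<in> T \<and> vadd p (?V x' y) a \<in> T \<and> vadd p (?V x'' y) b \<in> T})
        * real p ^ (s * 3) \<le> real (card T) * (real (card T) * real (card T)) * real p ^ n"
      by (simp only: of_nat_le_iff flip: of_nat_power of_nat_mult)
    also have "\<dots> = \<tau> ^ 3 * real p ^ n * real p ^ (s * 3)"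
      unfolding cardT by (simp add: power_mult power3_eq_cube)
    finally show ?thesis using p0 by simp
  qed
  have "density p (m + n) A = \<mu> * \<tau>"
  proof -
    have "card A = (\<Sum>x\<in>Fpn p m. card {y \<in> Fpn p n. x \<in> S \<and> ?V x y \<in> T})"
      unfolding A_def by (rule card_pr)
    also have "\<dots> = (\<Sum>x\<in>S. card {y \<in> Fpn p n. ?V x y \<in> T})"
      using S by (intro sum.mono_neutral_cong_right) auto
    finally have "real (card A) = (\<Sum>x\<in>S. real (card {y \<in> Fpn p n. ?V x y \<in> T}))" by simp
    also have "\<dots> = real (card S) * (\<tau> * real p ^ n)" by (simp add: fib1)
    finally show ?thesis using p0 by (simp add: density_def cardS power_add)
  qed
  moreover have "ap3_density p (m + n) A d * R \<le> (\<mu> * \<tau>) ^ 3"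
    if d: "d \<in> Fpn p (m + n)" "d \<noteq> (\<lambda>_. 0)" for d
  proof -
    define d1 d2 where "d1 = pr1 m d" and "d2 = pr2 m d"
    have "(d1, d2) \<in> (\<lambda>z. (pr1 m z, pr2 m z)) ` Fpn p (m + n)" using d by (auto simp: d1_def d2_def)
    then have d12: "d1 \<in> Fpn p m" "d2 \<in> Fpn p n"
      using bij_betw_imp_surj_on[OF bij_betw_pr, of m p n] by auto
    let ?P = "\<lambda>x y. (x \<in> S \<and> vadd p x d1 \<in> S \<and> vadd p (vadd p x d1) d1 \<in> S) \<and>
       ?V x y \<in> T \<and> ?V (vadd p x d1) (vadd p y d2) \<in> T \<and>
       ?V (vadd p (vadd p x d1) d1) (vadd p (vadd p y d2) d2) \<in> T"
    have "{z \<in> Fpn p (m + n). z \<in> A \<and> vadd p z d \<in> A \<and> vadd p (vadd p z d) d \<in> A}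
        = {z \<in> Fpn p (m + n). ?P (pr1 m z) (pr2 m z)}"
      using d vadd_in_Fpn[OF p0] by (auto simp: A_def pr_vadd d1_def d2_def)
    then have cnt: "card {z \<in> Fpn p (m + n). z \<in> A \<and> vadd p z d \<in> A \<and> vadd p (vadd p z d) d \<in> A}
        = (\<Sum>x\<in>Fpn p m. card {y \<in> Fpn p n. ?P x y})"
      using card_pr[of p m n ?P] by (simp only:)
    show ?thesis
    proof (cases "d1 = (\<lambda>_. 0)")
      case False
      let ?B = "{x \<in> Fpn p m. x \<in> S \<and> vadd p x d1 \<in> S \<and> vadd p (vadd p x d1) d1 \<in> S}"
      have "(\<Sum>x\<in>Fpn p m. card {y \<in> Fpn p n. ?P x y}) = (\<Sum>x\<in>?B. card {y \<in> Fpn p n. ?P x y})"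
        by (intro sum.mono_neutral_right) auto
      then have "real (\<Sum>x\<in>Fpn p m. card {y \<in> Fpn p n. ?P x y}) = (\<Sum>x\<in>?B. real (card {y \<in> Fpn p n. ?P x y}))"
        by simp
      also have "\<dots> \<le> (\<Sum>x\<in>?B. \<tau> ^ 3 * real p ^ n)"
      proof (rule sum_mono)
        fix x assume x: "x \<in> ?B"
        then have xF: "x \<in> Fpn p m" by simp
        \<comment> \<open>By linearity the shift of \<open>y\<close> by \<open>d2\<close> moves the
          value of each map by a vector independent of \<open>y\<close>; this is the situation of
          \<open>fib3\<close>.\<close>
        have "{y \<in> Fpn p n. ?P x y} = {y \<in> Fpn p n. ?V x y \<in> T \<and>
            vadd p (?V (vadd p x d1) y) (?V (vadd p x d1) d2) \<in> T \<and>
            vadd p (?V (vadd p (vadd p x d1) d1) y)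
              (vadd p (?V (vadd p (vadd p x d1) d1) d2) (?V (vadd p (vadd p x d1) d1) d2)) \<in> T}"
        proof -
          have "vadd p (vadd p a b) b = vadd p a (vadd p b b)" for a b
            by (simp add: vadd_def fun_eq_iff mod_add_left_eq mod_add_right_eq add.assoc)
          then show ?thesis using x by (simp add: matvec_vadd)
        qed
        then show "real (card {y \<in> Fpn p n. ?P x y}) \<le> \<tau> ^ 3 * real p ^ n"
          using fib3[OF _ _ _ vadd_twice_distinct[OF p xF d12(1) False]] x by simp
      qed
      also have "\<dots> = real (card ?B) * (\<tau> ^ 3 * real p ^ n)" by simp
      finally have "ap3_density p (m + n) A d \<le> real (card ?B) * (\<tau> ^ 3 * real p ^ n) / real p ^ (m + n)"
        unfolding ap3_density_def cnt by (rule divide_right_mono) simp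
      also have "\<dots> = ap3_density p m S d1 * \<tau> ^ 3"
        using p0 by (simp add: ap3_density_def power_add)
      finally have "ap3_density p (m + n) A d * R \<le> ap3_density p m S d1 * \<tau> ^ 3 * R"
        using R by (rule mult_right_mono)
      also have "\<dots> = (ap3_density p m S d1 * R) * \<tau> ^ 3" by simp
      also have "\<dots> \<le> \<mu> ^ 3 * \<tau> ^ 3"
        using ap[OF d12(1) False] \<tau>0 by (intro mult_right_mono) auto
      finally show ?thesis by (simp add: power_mult_distrib)
    next
      case True
      have d2: "d2 \<noteq> (\<lambda>_. 0)"
      proof
        assume "d2 = (\<lambda>_. 0)"
        have "d i = 0" for i
          using fun_cong[OF True, of i] fun_cong[OF \<open>d2 = (\<lambda>_. 0)\<close>, of "i - m"]
          by (cases "i < m") (simp_all add: d1_def d2_def pr1_def pr2_def)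
        then show False using d by auto
      qed
      let ?B = "{x \<in> S. \<forall>j<s. p dvd dot n (W (x, j)) d2}"
      \<comment> \<open>All three points lie over the same \<open>x\<close>, so their images under
        the one map V_x form a progression in \<open>T\<close> with difference V_x d2, which must
        vanish.\<close>
      have P0: "?P x y \<longrightarrow> x \<in> ?B \<and> ?V x y \<in> T" if x: "x \<in> Fpn p m" for x y
      proof
        assume P: "?P x y"
        then have "?V x y \<in> T" "vadd p (?V x y) (?V x d2) \<in> T" "vadd p (vadd p (?V x y) (?V x d2)) (?V x d2) \<in> T"
          using x by (simp_all add: True vadd_zero matvec_vadd)
        then have "?V x d2 = (\<lambda>_. 0)" using T VF unfolding apfree_def by blast
        then have "\<forall>j<s. p dvd dot n (W (x, j)) d2"
          by (metis dvd_eq_mod_eq_0 matvec_def)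
        then show "x \<in> ?B \<and> ?V x y \<in> T" using P by simp
      qed
      have "(\<Sum>x\<in>Fpn p m. card {y \<in> Fpn p n. ?P x y}) = (\<Sum>x\<in>?B. card {y \<in> Fpn p n. ?P x y})"
      proof (rule sum.mono_neutral_right)
        show "\<forall>x\<in>Fpn p m - ?B. card {y \<in> Fpn p n. ?P x y} = 0"
        proof
          fix x assume x: "x \<in> Fpn p m - ?B"
          then have "{y \<in> Fpn p n. ?P x y} = {}" using P0[of x] by blast
          then show "card {y \<in> Fpn p n. ?P x y} = 0" by (simp only: card.empty)
        qed
      qed (use S in auto)
      also have "\<dots> \<le> (\<Sum>x\<in>?B. card {y \<in> Fpn p n. ?V x y \<in> T})"
        by (intro sum_mono card_mono) auto
      finally have "real (\<Sum>x\<in>Fpn p m. card {y \<in> Fpn p n. ?P x y}) \<le> (\<Sum>x\<in>?B. real (card {y \<in> Fpn p n. ?V x y \<in> T}))"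
        by (simp only: of_nat_le_iff flip: of_nat_sum)
      also have "\<dots> = real (card ?B) * (\<tau> * real p ^ n)" by (simp add: fib1)
      also have "\<dots> \<le> real n * (\<tau> * real p ^ n)"
        using few[OF d12(2) d2] \<tau>0 by (intro mult_right_mono) auto
      finally have "ap3_density p (m + n) A d \<le> real n * (\<tau> * real p ^ n) / real p ^ (m + n)"
        unfolding ap3_density_def cnt by (rule divide_right_mono) simp
      also have "\<dots> = real n * \<tau> / real p ^ m" using p0 by (simp add: power_add)
      finally have "ap3_density p (m + n) A d * R \<le> real n * \<tau> / real p ^ m * R"
        using R by (rule mult_right_mono)
      also have "\<dots> = (real n * R) * (\<tau> / real p ^ m)" by simp
      also have "\<dots> \<le> (\<mu> ^ 3 * \<tau> ^ 2 * real p ^ m) * (\<tau> / real p ^ m)"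
        using c2 \<tau>0 p0 by (intro mult_right_mono) (auto simp: \<tau>_def)
      also have "\<dots> = (\<mu> * \<tau>) ^ 3" using p0 by (simp add: power_mult_distrib power3_eq_cube power2_eq_square)
      finally show ?thesis .
    qed
  qed
  moreover have "A \<subseteq> Fpn p (m + n)" by (auto simp: A_def)
  ultimately show ?thesis unfolding sparse_def \<tau>_def by blast
qed

section \<open>Progression-free sets of Behrend type\<close>

lemma apfree_subset: "apfree p s T \<Longrightarrow> T' \<subseteq> T \<Longrightarrow> apfree p s T'"
  unfolding apfree_def by blast

text \<open>All progression counts vanish, so \<open>R\<close> is arbitrary; this supplies the set
  from which the iteration starts.\<close>

lemma apfree_imp_sparse:
  assumes "apfree p m T"
  shows "sparse p R m (density p m T)"
proof -
  have "ap3_density p m T d = 0" if "d \<in> Fpn p m" "d \<noteq> (\<lambda>_. 0)" for d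
  proof -
    have "{x \<in> Fpn p m. x \<in> T \<and> vadd p x d \<in> T \<and> vadd p (vadd p x d) d \<in> T} = {}"
      using assms that unfolding apfree_def by blast
    then show ?thesis by (simp add: ap3_density_def)
  qed
  moreover have "density p m T \<ge> 0" by (simp add: density_def)
  ultimately show ?thesis using assms unfolding sparse_def apfree_def by (intro exI[of _ T]) auto
qed

text \<open>Coordinates are at most (p-1)/2, so sums of two do not wrap around and a progression mod
  \<open>p\<close> satisfies x + z = 2y over the integers. The parallelogram law |x|^2 + |z|^2 = 2
  |y|^2 + 2 |y-x|^2 then forces x = y on a sphere.\<close>

lemma sphere_apfree:
  assumes p: "prime p" "p \<ge> 3"
  shows "apfree p s {x \<in> Fpn ((p + 1) div 2) s. (\<Sum>i<s. x i ^ 2) = v}"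
proof -
  let ?h = "(p + 1) div 2"
  let ?T = "{x \<in> Fpn ?h s. (\<Sum>i<s. x i ^ 2) = v}"
  have h: "?h \<le> p" using p by simp
  have sub: "Fpn ?h s \<subseteq> Fpn p s" using h by (fastforce simp: Fpn_def)
  have "w = (\<lambda>_. 0)"
    if x: "x \<in> ?T" and w: "w \<in> Fpn p s" and y: "vadd p x w \<in> ?T" and z: "vadd p (vadd p x w) w \<in> ?T" for x w
  proof (rule ccontr)
    assume w0: "w \<noteq> (\<lambda>_. 0)"
    let ?y = "vadd p x w" and ?z = "vadd p (vadd p x w) w"
    define \<delta> where "\<delta> i = int (?y i) - int (x i)" for i
    have mid: "x i + ?z i = 2 * ?y i" if i: "i < s" for i
    proof -
      have lt: "x i < ?h" "?y i < ?h" "?z i < ?h" using x y z i by (auto simp: Fpn_def)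
      have "(x i + ?z i) mod p = (x i + (?y i + w i)) mod p"
        by (simp add: vadd_apply[of p ?y] mod_add_right_eq)
      also have "\<dots> = (?y i + (x i + w i)) mod p" by (simp add: add.left_commute)
      also have "\<dots> = (?y i + ?y i) mod p" by (simp add: vadd_apply[of p x] mod_add_right_eq)
      finally show ?thesis using lt by simp
    qed
    have "int (x i) ^ 2 + int (?z i) ^ 2 = 2 * int (?y i) ^ 2 + 2 * \<delta> i ^ 2" if "i < s" for i
    proof -
      have "int (?z i) = 2 * int (?y i) - int (x i)" using mid[OF that] by linarith
      then show ?thesis unfolding \<delta>_def by (simp only:) (simp add: power2_eq_square algebra_simps)
    qed
    then have "(\<Sum>i<s. int (x i) ^ 2 + int (?z i) ^ 2) = (\<Sum>i<s. 2 * int (?y i) ^ 2 + 2 * \<delta> i ^ 2)"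
      by (intro sum.cong) auto
    then have "int (\<Sum>i<s. x i ^ 2) + int (\<Sum>i<s. ?z i ^ 2) = 2 * int (\<Sum>i<s. ?y i ^ 2) + 2 * (\<Sum>i<s. \<delta> i ^ 2)"
      by (simp add: sum.distrib sum_distrib_left)
    moreover have "(\<Sum>i<s. x i ^ 2) = v" "(\<Sum>i<s. ?y i ^ 2) = v" "(\<Sum>i<s. ?z i ^ 2) = v"
      using x y z by blast+
    ultimately have "(\<Sum>i<s. \<delta> i ^ 2) = 0" by simp
    then have \<delta>0: "\<forall>i\<in>{..<s}. \<delta> i ^ 2 = 0" by (subst (asm) sum_nonneg_eq_0_iff) auto
    have "x = ?y"
    proof
      fix i
      show "x i = ?y i"
      proof (cases "i < s")
        case True
        then have "\<delta> i ^ 2 = 0" using \<delta>0 by blast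
        then show ?thesis by (simp add: \<delta>_def)
      qed (use x y in \<open>simp add: Fpn_def\<close>)
    qed
    moreover have "x \<in> Fpn p s" using x sub by blast
    ultimately show False using vadd_twice_distinct(1)[OF p _ w w0] by blast
  qed
  moreover have "?T \<subseteq> Fpn p s" using sub by blast
  ultimately show ?thesis unfolding apfree_def by blast
qed

text \<open>Pigeonhole: the squared norm takes fewer than s p^2 + 1 values on the box, whose density
  is ((p+1)/(2p))^s.\<close>

lemma behrend_set:
  assumes p: "prime p" "p \<ge> 3" and s: "s \<ge> 1"
  obtains T where "apfree p s T" "density p s T * (real s * real p ^ 2) \<ge> (real (p + 1) / (2 * real p)) ^ s"
proof -
  let ?h = "(p + 1) div 2"
  define T where "T v = {x \<in> Fpn ?h s. (\<Sum>i<s. x i ^ 2) = v}" for v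
  have bound: "(\<Sum>i<s. x i ^ 2) < s * p ^ 2" if x: "x \<in> Fpn ?h s" for x
  proof -
    have "(\<Sum>i<s. x i ^ 2) < (\<Sum>i<s. p ^ 2)"
    proof (rule sum_strict_mono)
      fix i assume "i \<in> {..<s}"
      then have "x i < p" using x p by (auto simp: Fpn_def less_le_trans)
      then show "x i ^ 2 < p ^ 2" by (rule power_strict_mono) auto
    qed (use s in \<open>auto simp: lessThan_empty_iff\<close>)
    then show ?thesis by simp
  qed
  have "\<exists>v. ?h ^ s \<le> card (T v) * (s * p ^ 2)"
  proof (rule ccontr)
    assume "\<not> ?thesis"
    then have lt: "card (T v) * (s * p ^ 2) < ?h ^ s" for v by (simp add: not_le)
    have "card (Fpn ?h s) = (\<Sum>v<s * p ^ 2. card (T v))"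
    proof -
      have "Fpn ?h s = (\<Union>v<s * p ^ 2. T v)" using bound by (auto simp: T_def)
      also have "card \<dots> = (\<Sum>v<s * p ^ 2. card (T v))"
        by (intro card_UN_disjoint) (auto simp: T_def)
      finally show ?thesis .
    qed
    then have "?h ^ s * (s * p ^ 2) = (\<Sum>v<s * p ^ 2. card (T v) * (s * p ^ 2))"
      by (simp add: sum_distrib_right)
    also have "\<dots> < (\<Sum>v<s * p ^ 2. ?h ^ s)"
      using p s by (intro sum_strict_mono lt) (auto simp: lessThan_empty_iff)
    finally show False by simp
  qed
  then obtain v where v: "?h ^ s \<le> card (T v) * (s * p ^ 2)" by blast
  have "odd p" using p prime_odd_nat by auto
  then have "real ?h = real (p + 1) / 2" by (auto elim!: oddE)
  then have "real (p + 1) / (2 * real p) = real ?h / real p" by (simp only: divide_divide_eq_left)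
  then have "(real (p + 1) / (2 * real p)) ^ s = real ?h ^ s / real p ^ s"
    by (simp only: power_divide)
  also have "\<dots> \<le> real (card (T v)) * (real s * real p ^ 2) / real p ^ s"
  proof (rule divide_right_mono)
    have "real (?h ^ s) \<le> real (card (T v) * (s * p ^ 2))" using v by (simp only: of_nat_le_iff)
    then show "real ?h ^ s \<le> real (card (T v)) * (real s * real p ^ 2)" by simp
  qed simp
  also have "\<dots> = density p s (T v) * (real s * real p ^ 2)" by (simp add: density_def)
  finally show ?thesis using sphere_apfree[OF p, of s v] that[of "T v"] by (simp add: T_def)
qed

section \<open>The iteration step in logarithmic form\<close>

lemma log2_ge_19:
  assumes "p \<ge> (19::nat)" shows "log 2 (real p) \<ge> 424/100"
proof -
  \<comment> \<open>106/25 = 4.24 lies just below log 19, which is about 4.248.\<close>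
  have "(2::real) ^ 106 \<le> 19 ^ 25" by simp
  also have "\<dots> \<le> real p ^ 25" using assms by (intro power_mono) auto
  finally have "log 2 (2 ^ 106) \<le> log 2 (real p ^ 25)" using assms by simp
  moreover have "log 2 ((2::real) ^ 106) = 106" by (subst log_nat_power) auto
  ultimately have "106 \<le> 25 * log 2 (real p)" using assms by (simp add: log_nat_power)
  then show ?thesis by simp
qed

lemma power_eq_2_powr:
  assumes "p > (0::nat)" shows "real p ^ m = 2 powr (log 2 (real p) * real m)"
  using assms by (simp add: powr_powr[symmetric] powr_realpow)

lemma two_powr_ge_square:
  assumes "x \<ge> (0::real)" shows "2 powr x \<ge> 2 / 9 * x ^ 2"
proof -
  have "2 / 3 * x \<le> ln 2 * x" using ln2_ge_two_thirds assms by (intro mult_right_mono) auto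
  then have "(2 / 3 * x) ^ 2 \<le> (x * ln 2) ^ 2" using assms by (intro power_mono) (auto simp: mult.commute)
  moreover have "(x * ln 2) ^ 2 / 2 \<le> exp (x * ln 2)"
  proof -
    have "1 + x * ln 2 + (x * ln 2) ^ 2 / 2 \<le> exp (x * ln 2)"
      using assms by (intro exp_lower_Taylor_quadratic) auto
    moreover have "x * ln 2 \<ge> 0" using assms by simp
    ultimately show ?thesis by linarith
  qed
  ultimately show ?thesis by (simp add: powr_def power_mult_distrib power_divide)
qed

lemma two_powr_ge_linear:
  assumes "x \<ge> (0::real)" "c \<le> 2 / 9 * x" shows "c * x \<le> 2 powr x"
proof -
  have "c * x \<le> 2 / 9 * x * x" using assms by (intro mult_right_mono) auto
  also have "\<dots> \<le> 2 powr x" using two_powr_ge_square[OF assms(1)] by (simp add: power2_eq_square)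
  finally show ?thesis .
qed

text \<open>Concavity: \<open>ln\<close> lies below its tangent at 3000. This gives x/3000 plus
  about 7.4, and from 10^5 on the constant fits into the gap between x/3000 and x/2250.\<close>

lemma log2_le_linear:
  assumes "x \<ge> 10 ^ 5" shows "log 2 x \<le> x / 1500"
proof -
  have "ln x = ln (x / 3000) + ln 3000" using assms by (simp add: ln_div)
  also have "ln (x / 3000) \<le> x / 3000 - 1" using assms by (intro ln_le_minus_one) auto
  also have "ln (3000::real) \<le> ln (2 ^ 12)" by (subst ln_le_cancel_iff) auto
  also have "ln (2 ^ 12 :: real) = 12 * ln 2" by (subst ln_realpow) auto
  also have "\<dots> \<le> 12 * (25 / 36)" using ln2_le_25_over_36 by simp
  finally have "ln x \<le> x / 2250" using assms by simp
  also have "\<dots> = x / 1500 * (2 / 3)" by simp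
  also have "\<dots> \<le> x / 1500 * ln 2" using ln2_ge_two_thirds assms by (intro mult_left_mono) auto
  finally show ?thesis by (simp add: log_def field_simps)
qed

text \<open>The numerical constraint that forces \<open>p \<ge> 19\<close>: for the densities \<open>p powr (- \<delta> s)\<close> the first
  iteration step needs \<open>1 - 5 \<delta> + 2 \<delta>\<^sup>2 > 0\<close>, that is \<open>\<delta> < 0.2192\<close>.\<close>

lemma half_density_exponent:
  assumes "prime p" "p \<ge> 19"
  shows "log 2 (2 * real p / real (p + 1)) \<le> 2181 / 10000 * log 2 (real p)"
proof -
  \<comment> \<open>Reduces the logarithmic bound to an inequality between powers with a rational
    exponent j/k of at most 0.2181.\<close>
  have red: ?thesis if "(2 * real p / real (p + 1)) ^ k \<le> real p ^ j" "10000 * real j \<le> 2181 * real k" "k > 0" for j k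
  proof -
    have pos: "2 * real p / real (p + 1) > 0" "real p > 0" using assms by simp_all
    then have "log 2 ((2 * real p / real (p + 1)) ^ k) \<le> log 2 (real p ^ j)"
      using that(1) pos by (subst log_le_cancel_iff) auto
    then have "real k * log 2 (2 * real p / real (p + 1)) \<le> real j * log 2 (real p)"
      by (simp only: log_nat_power[OF less_imp_le[OF pos(1)]] log_nat_power[OF less_imp_le[OF pos(2)]])
    also have "\<dots> \<le> 2181 / 10000 * real k * log 2 (real p)"
      using that(2) assms by (intro mult_right_mono) auto
    finally have "real k * log 2 (2 * real p / real (p + 1)) \<le> real k * (2181 / 10000 * log 2 (real p))"
      by simp
    then show ?thesis using that(3) by (subst (asm) mult_le_cancel_left_pos) auto
  qed
  consider "p = 19" | "p = 20" | "p = 21" | "p = 22" | "p = 23" | "p = 24" | "p \<ge> 25"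
    using assms(2) by linarith
  then show ?thesis
  proof cases
    case 7
    have "(2 * real p / real (p + 1)) ^ 23 \<le> 2 ^ 23" by (intro power_mono) (auto simp: field_simps)
    also have "\<dots> \<le> (25 :: real) ^ 5" by simp
    also have "\<dots> \<le> real p ^ 5" using 7 by (intro power_mono) auto
    finally show ?thesis by (rule red) simp_all
  next
    case 1
    \<comment> \<open>The tight case: the logarithm of 1.9 to base 19 is about 0.21799, and 29/133
      is about 0.21805. For 23 and above the coarser 5/23 is enough.\<close>
    have "(19 / 10) ^ 133 \<le> (19 :: real) ^ 29" by (simp add: power_divide)
    then show ?thesis using 1 by (intro red[of 133 29]) simp_all
  next
    case 2
    then show ?thesis using assms(1) by simp
  next
    case 3
    then have "3 dvd p" by simp
    then show ?thesis using assms by (auto simp: prime_nat_iff)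
  next
    case 4
    then have "2 dvd p" by simp
    then show ?thesis using assms by (auto simp: prime_nat_iff)
  next
    case 5
    have "(23 / 12) ^ 23 \<le> (23 :: real) ^ 5" by (simp add: power_divide)
    then show ?thesis using 5 by (intro red[of 23 5]) simp_all
  next
    case 6
    then have "2 dvd p" by simp
    then show ?thesis using assms by (auto simp: prime_nat_iff)
  qed
qed

text \<open>For such \<open>s\<close> the pigeonhole loss s p^2 is at most 2^(s/750). The first
  bound has an exponent independent of \<open>p\<close>, so the loss is small against s log p for
  large \<open>p\<close> and drives the iteration. The second is the sharper one for small
  \<open>p\<close>, where the first step has hardly any room.\<close>

lemma dense_apfree:
  assumes p: "prime p" "p \<ge> 19" and s: "real s \<ge> 3000 * log 2 (real p)" "real s \<ge> 10 ^ 5"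
  obtains T where "apfree p s T" "density p s T \<ge> 2 powr (- (5 / 4 * real s))"
    "density p s T \<ge> 2 powr (- (2185 / 10000 * log 2 (real p) * real s))"
proof -
  define \<Lambda> where "\<Lambda> = log 2 (real p)"
  define \<kappa> where "\<kappa> = log 2 (2 * real p / real (p + 1))"
  have s1: "s \<ge> 1" and p3: "p \<ge> 3" using s p by auto
  obtain T where T: "apfree p s T"
    and d: "density p s T * (real s * real p ^ 2) \<ge> (real (p + 1) / (2 * real p)) ^ s"
    by (rule behrend_set[OF p(1) p3 s1])
  have "real (p + 1) / (2 * real p) = 2 powr (- \<kappa>)"
    using p by (simp add: \<kappa>_def powr_minus inverse_eq_divide)
  then have "(real (p + 1) / (2 * real p)) ^ s = 2 powr (- \<kappa> * real s)"
    by (simp add: powr_powr flip: powr_realpow)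
  moreover have "real s * real p ^ 2 \<le> 2 powr (real s / 750)"
  proof -
    have "real s = 2 powr log 2 (real s)" using s1 by simp
    also have "\<dots> \<le> 2 powr (real s / 1500)" using log2_le_linear[OF s(2)] by simp
    finally have "real s \<le> 2 powr (real s / 1500)" .
    moreover have "real p ^ 2 \<le> 2 powr (real s / 1500)"
    proof -
      have "real p ^ 2 = 2 powr (\<Lambda> * 2)" unfolding \<Lambda>_def using power_eq_2_powr[of p 2] p by simp
      also have "\<dots> \<le> 2 powr (real s / 1500)" using s(1) by (simp add: \<Lambda>_def)
      finally show ?thesis .
    qed
    ultimately have "real s * real p ^ 2 \<le> 2 powr (real s / 1500) * 2 powr (real s / 1500)"
      by (intro mult_mono) auto
    then show ?thesis by (simp flip: powr_add)
  qed
  moreover have "density p s T \<ge> 0" by (simp add: density_def)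
  ultimately have "2 powr (- \<kappa> * real s) \<le> density p s T * 2 powr (real s / 750)"
    using d mult_left_mono[of "real s * real p ^ 2" "2 powr (real s / 750)" "density p s T"] by linarith
  then have "2 powr (- \<kappa> * real s) * 2 powr (- (real s / 750)) \<le> density p s T"
    by (simp add: powr_minus field_simps)
  then have main: "2 powr (- (\<kappa> + 1 / 750) * real s) \<le> density p s T"
    by (simp add: algebra_simps flip: powr_add)
  have "\<kappa> \<le> log 2 2" unfolding \<kappa>_def using p by (subst log_le_cancel_iff) (auto simp: field_simps)
  then have k1: "(\<kappa> + 1 / 750) * real s \<le> 5 / 4 * real s" by (intro mult_right_mono) auto
  have "\<Lambda> \<ge> 424 / 100" unfolding \<Lambda>_def using p log2_ge_19 by simp
  moreover have "\<kappa> \<le> 2181 / 10000 * \<Lambda>" unfolding \<Lambda>_def \<kappa>_def using p by (rule half_density_exponent)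
  ultimately have "\<kappa> + 1 / 750 \<le> 2185 / 10000 * \<Lambda>" by linarith
  then have k2: "(\<kappa> + 1 / 750) * real s \<le> 2185 / 10000 * \<Lambda> * real s" by (rule mult_right_mono) simp
  have "2 powr (- (5 / 4 * real s)) \<le> 2 powr (- (\<kappa> + 1 / 750) * real s)"
    using k1 by (intro powr_mono) (simp_all only: mult_minus_left neg_le_iff_le one_le_numeral)
  moreover have "2 powr (- (2185 / 10000 * \<Lambda> * real s)) \<le> 2 powr (- (\<kappa> + 1 / 750) * real s)"
    using k2 by (intro powr_mono) (simp_all only: mult_minus_left neg_le_iff_le one_le_numeral)
  ultimately show ?thesis using that[OF T] main unfolding \<Lambda>_def by linarith
qed

text \<open>Here \<open>u\<close>, \<open>v\<close>, \<open>B\<close> bound the binary logarithms of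
  1/\<mu>, of the inverse density of \<open>T\<close>, and of 6 p^2 R. The new dimension is the
  upper end \<open>Y\<close> of the window, rounded down. As \<open>Y\<close> is at least 2,
  rounding loses at most half; this is why the constant is 6, twice the 3 of the lower end. The
  condition on \<open>s\<close> says that the lower end is at most Y/2.\<close>

lemma sparse_step_log:
  assumes p: "prime p" "p \<ge> 3" and R: "R \<ge> 1" "6 * real p ^ 2 * R \<le> 2 powr B"
    and sp: "sparse p R m \<mu>" and \<mu>: "\<mu> \<ge> 2 powr (- u)"
    and T: "apfree p s T" "density p s T \<ge> 2 powr (- v)"
    and s: "2 * u + 2 * v + B \<le> log 2 (real p) * real s"
    and g: "g = log 2 (real p) * real m - 3 * u - 2 * v - B"
    and big: "3 * real m + 3 * real s + 1 \<le> 2 powr g"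
  obtains n where "real n \<ge> 2 powr g" "sparse p R (m + n) (\<mu> * density p s T)"
proof -
  define \<tau> where "\<tau> = density p s T"
  define Y where "Y = \<mu> ^ 3 * \<tau> ^ 2 * real p ^ m / R"
  define n where "n = nat \<lfloor>Y\<rfloor>"
  have p0: "p > 0" using p by simp
  have \<mu>0: "\<mu> > 0" using \<mu> by (metis less_le_trans powr_gt_zero zero_neq_numeral)
  have \<tau>: "\<tau> \<ge> 2 powr (- v)" using T by (simp add: \<tau>_def)
  then have \<tau>0: "\<tau> > 0" by (metis less_le_trans powr_gt_zero zero_neq_numeral)
  have \<mu>k: "\<mu> ^ k \<ge> 2 powr (- (k * u))" for k
  proof -
    have "2 powr (- (k * u)) = (2 powr (- u)) ^ k" by (simp add: powr_powr mult.commute flip: powr_realpow)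
    also have "\<dots> \<le> \<mu> ^ k" using \<mu> by (intro power_mono) auto
    finally show ?thesis .
  qed
  have \<tau>2: "\<tau> ^ 2 \<ge> 2 powr (- (2 * v))"
  proof -
    have "2 powr (- (2 * v)) = (2 powr (- v)) ^ 2" by (simp add: powr_powr mult.commute flip: powr_realpow)
    also have "\<dots> \<le> \<tau> ^ 2" using \<tau> by (intro power_mono) auto
    finally show ?thesis .
  qed
  have "2 * 2 powr g * R \<le> \<mu> ^ 3 * \<tau> ^ 2 * real p ^ m"
  proof -
    have "2 * R \<le> 6 * real p ^ 2 * R"
    proof (rule mult_right_mono)
      have "1 ^ 2 \<le> real p ^ 2" using p by (intro power_mono) auto
      then show "2 \<le> 6 * real p ^ 2" by simp
    qed (use R in simp)
    then have "2 * R \<le> 2 powr B" using R by linarith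
    then have "2 powr g * (2 * R) \<le> 2 powr g * 2 powr B" by (intro mult_left_mono) auto
    also have "\<dots> = 2 powr (- (3 * u)) * 2 powr (- (2 * v)) * real p ^ m"
      unfolding power_eq_2_powr[OF p0] g by (simp add: algebra_simps flip: powr_add)
    also have "\<dots> \<le> \<mu> ^ 3 * \<tau> ^ 2 * real p ^ m"
      using \<mu>k[of 3] \<tau>2 \<mu>0 by (intro mult_mono) auto
    finally show ?thesis by simp
  qed
  then have Y: "2 * 2 powr g \<le> Y" using R by (simp add: Y_def field_simps)
  have g1: "2 powr g \<ge> 1" using big by linarith
  then have Y0: "Y \<ge> 0" using Y by linarith
  have nY: "real n \<le> Y" "Y - 1 \<le> real n" using Y0 unfolding n_def by linarith+
  have ng: "real n \<ge> 2 powr g" using nY Y g1 by linarith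
  have nh: "Y / 2 \<le> real n" using nY Y g1 by linarith
  have "sparse p R (m + n) (\<mu> * density p s T)"
  proof (rule sparse_step[OF p sp T(1)])
    have "real (3 * m + 3 * s + 1) \<le> real n" using ng big by simp
    then show "3 * m + 3 * s + 1 \<le> n" by linarith
    show "real n * R \<le> \<mu> ^ 3 * (density p s T)\<^sup>2 * real p ^ m"
    proof -
      have "real n * R \<le> Y * R" using nY R by (intro mult_right_mono) auto
      then show ?thesis using R by (simp add: Y_def \<tau>_def)
    qed
    show "3 * real p ^ 2 * \<mu> * real p ^ m \<le> real n * real p ^ s"
    proof -
      have "6 * real p ^ 2 * R \<le> 2 powr (- (2 * u)) * 2 powr (- (2 * v)) * real p ^ s"
      proof -
        have "2 powr B \<le> 2 powr (- (2 * u) + - (2 * v) + log 2 (real p) * real s)"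
          using s by (intro powr_mono) auto
        also have "\<dots> = 2 powr (- (2 * u)) * 2 powr (- (2 * v)) * real p ^ s"
          unfolding power_eq_2_powr[OF p0] powr_add by (rule refl)
        finally show ?thesis using R by linarith
      qed
      also have "\<dots> \<le> \<mu> ^ 2 * \<tau> ^ 2 * real p ^ s"
        using \<mu>k[of 2] \<tau>2 \<mu>0 by (intro mult_mono) auto
      finally have "6 * real p ^ 2 * R * (\<mu> * real p ^ m / (2 * R))
          \<le> \<mu> ^ 2 * \<tau> ^ 2 * real p ^ s * (\<mu> * real p ^ m / (2 * R))"
        using \<mu>0 R by (intro mult_right_mono) auto
      then have "3 * real p ^ 2 * \<mu> * real p ^ m \<le> Y / 2 * real p ^ s"
        using R by (simp add: Y_def field_simps power3_eq_cube power2_eq_square)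
      also have "\<dots> \<le> real n * real p ^ s" using nh by (intro mult_right_mono) auto
      finally show ?thesis .
    qed
  qed (use R in simp)
  then show ?thesis using that ng by blast
qed

section \<open>Iterating to tower height\<close>

text \<open>In \<open>stage p R B t w\<close> the dimension exceeds the tower value \<open>t\<close> by a multiple of \<open>w\<close>, the bound on
  the logarithmic density (shifted by the constant \<open>B\<close>); this reserve pays for the losses of the
  next step.\<close>

definition stage :: "nat \<Rightarrow> real \<Rightarrow> real \<Rightarrow> real \<Rightarrow> real \<Rightarrow> bool" where
  "stage p R B t w \<longleftrightarrow> (\<exists>m \<mu>. sparse p R m \<mu> \<and> \<mu> \<ge> 2 powr (B - w) \<and>
     log 2 (real p) * t + 10 * w \<le> log 2 (real p) * real m)"

lemma ceiling_bounds:
  fixes x :: real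
  assumes "x \<ge> 0"
  shows "x \<le> real (nat \<lceil>x\<rceil>)" "real (nat \<lceil>x\<rceil>) \<le> x + 1"
  using assms by linarith+

text \<open>With x = w/L and \<open>s\<close> about 8x, the density loses about 10x bits. Adding
  15x, which also covers rounding, gives w (1 + 15/L), at most w exp(15/L).\<close>

lemma stage_step:
  assumes p: "prime p" "p \<ge> 19" and R: "R \<ge> 1" "6 * real p ^ 2 * R \<le> 2 powr B"
    and B: "0 \<le> B" "B \<le> w" and w: "w \<ge> 1000 * log 2 (real p) ^ 2" "w \<ge> 50000 * log 2 (real p)"
    and t: "t \<ge> 1" and st: "stage p R B t w"
  shows "stage p R B (real p powr t) (w * exp (15 / log 2 (real p)))"
proof -
  define L where "L = log 2 (real p)"
  have L: "L \<ge> 424 / 100" unfolding L_def using p log2_ge_19 by simp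
  obtain m \<mu> where sp: "sparse p R m \<mu>" and \<mu>: "\<mu> \<ge> 2 powr (- (w - B))" and m: "L * t + 10 * w \<le> L * real m"
    using st unfolding stage_def L_def by auto
  define x where "x = w / L"
  have w': "w = L * x" using L by (simp add: x_def)
  have x: "x \<ge> 1000 * L" "x \<ge> 50000"
    using w L by (simp_all add: x_def field_simps power2_eq_square flip: L_def)
  have w0: "w \<ge> 50000 * L" using w by (simp add: L_def)
  define s where "s = nat \<lceil>8 * x\<rceil>"
  have s: "8 * x \<le> real s" "real s \<le> 8 * x + 1" using ceiling_bounds[of "8 * x"] x by (simp_all add: s_def)
  have s': "real s \<ge> 3000 * log 2 (real p)" "real s \<ge> 10 ^ 5"
    using s x L by (simp_all flip: L_def)
  obtain T where T: "apfree p s T" and dT: "density p s T \<ge> 2 powr (- (5 / 4 * real s))"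
    by (rule dense_apfree[OF p s'])
  define g where "g = L * real m - 3 * (w - B) - 2 * (5 / 4 * real s) - B"
  have Lx: "w \<ge> 424 / 100 * x" using L x unfolding w' by (intro mult_right_mono) auto
  have mx: "real m \<ge> 10 * x + t"
  proof -
    have "L * (t + 10 * x) \<le> L * real m" using m w' by (simp add: algebra_simps)
    then show ?thesis using L by (subst (asm) mult_le_cancel_left_pos) auto
  qed
  have Lm: "L * real m \<ge> 424 / 100 * real m" using L by (intro mult_right_mono) auto
  have "2 * (5 / 4 * real s) \<le> 48 / 10 * w" using s(2) Lx x(2) by linarith
  \<comment> \<open>Of the reserve 10w, the cube of the old density takes 3w and the square of the
    new one 4.8w. More than 2w is left, a factor 2^(2w) in the dimension that pays for the next
    reserve.\<close>
  then have gw: "g \<ge> L * real m - 78 / 10 * w" unfolding g_def right_diff_distrib using B(1) by linarith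
  have Lt: "L * t \<ge> 0" using L t by simp
  then have "10 * w \<le> L * real m" using m by linarith
  then have gm: "g \<ge> real m / 2" using gw Lm of_nat_0_le_iff[of m, where 'a = real] by linarith
  have gt: "g \<ge> L * t + 2 * w" using gw m x Lx by linarith
  have "3 * real m + 3 * real s + 1 \<le> 6 * real m" using s mx x t by linarith
  also have "\<dots> = 12 * (real m / 2)" by simp
  also have "\<dots> \<le> 2 powr (real m / 2)" using mx x t by (intro two_powr_ge_linear) auto
  also have "\<dots> \<le> 2 powr g" using gm by simp
  finally have big: "3 * real m + 3 * real s + 1 \<le> 2 powr g" .
  have cond: "2 * (w - B) + 2 * (5 / 4 * real s) + B \<le> L * real s"
  proof -
    have "(L - 5 / 2) * (8 * x) \<le> (L - 5 / 2) * real s" using s L by (intro mult_left_mono) auto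
    then have "8 * w - 20 * x \<le> L * real s - 5 / 2 * real s" unfolding w' by (simp add: algebra_simps)
    then show ?thesis unfolding right_diff_distrib using Lx B x by linarith
  qed
  have p3: "p \<ge> 3" using p by simp
  obtain n where n: "real n \<ge> 2 powr g" and sp': "sparse p R (m + n) (\<mu> * density p s T)"
    by (rule sparse_step_log[OF p(1) p3 R sp \<mu> T dT, of g]) (use cond big in \<open>auto simp: g_def L_def\<close>)
  define w1 where "w1 = w * exp (15 / L)"
  have w1a: "w + 5 / 4 * real s \<le> w1"
  proof -
    have "w * (1 + 15 / L) \<le> w1" unfolding w1_def using w0 L by (intro mult_left_mono exp_ge_add_one_self) auto
    then have "w + 15 * x \<le> w1" by (simp add: algebra_simps x_def)
    then show ?thesis using s x by linarith
  qed
  have w1b: "w1 \<le> 81 * w"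
  proof -
    \<comment> \<open>15 / 4.24 is below 4 and e is at most 3, hence 81; ten times this is the 810
      below.\<close>
    have "exp (15 / L) \<le> exp (of_nat 4 * 1)" using L by (subst exp_le_cancel_iff) (simp add: field_simps)
    also have "\<dots> = exp 1 ^ 4" by (rule exp_of_nat_mult)
    also have "\<dots> \<le> 3 ^ 4" by (intro power_mono exp_le) simp
    finally have "exp (15 / L) \<le> 81" by simp
    then show ?thesis unfolding w1_def using w0 L by (simp add: mult.commute mult_right_mono)
  qed
  have "\<mu> * density p s T \<ge> 2 powr (- (w - B)) * 2 powr (- (5 / 4 * real s))"
    using \<mu> dT by (intro mult_mono) (auto intro: order_trans[OF powr_ge_zero])
  moreover have "2 powr (- (w - B)) * 2 powr (- (5 / 4 * real s)) \<ge> 2 powr (B - w1)"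
    unfolding powr_add[symmetric] using w1a by (intro powr_mono) auto
  moreover have "L * real p powr t + 10 * w1 \<le> L * real (m + n)"
  proof -
    have pt: "real p powr t = 2 powr (L * t)" using p by (simp add: L_def powr_powr[symmetric])
    have pt1: "real p powr t \<ge> 1" using p t by (intro ge_one_powr_ge_zero) auto
    have "real p powr t * 2 powr (2 * w) \<le> 2 powr g"
      unfolding pt using gt by (simp flip: powr_add)
    moreover have "1 + 810 * w \<le> 2 powr (2 * w)"
    proof -
      have "1 + 810 * w \<le> 406 * (2 * w)" using w0 L by linarith
      also have "\<dots> \<le> 2 powr (2 * w)" using w0 L by (intro two_powr_ge_linear) linarith+
      finally show ?thesis .
    qed
    ultimately have "real p powr t * (1 + 810 * w) \<le> real n"
      using pt1 n by (meson mult_left_mono order_trans powr_ge_zero)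
    moreover have "810 * w \<le> real p powr t * (810 * w)"
      using mult_right_mono[OF pt1, of "810 * w"] w0 L by simp
    ultimately have "real p powr t + 10 * w1 \<le> real n" using w1b by (simp add: algebra_simps)
    then have "L * (real p powr t + 10 * w1) \<le> L * real n" using L by (intro mult_left_mono) auto
    moreover have "10 * w1 \<le> L * (10 * w1)"
      using mult_right_mono[of 1 L "10 * w1"] L w1a w0 by simp
    moreover have "0 \<le> L * real m" using L by simp
    ultimately show ?thesis by (simp add: algebra_simps)
  qed
  ultimately show ?thesis using sp' unfolding stage_def w1_def L_def
    by (intro exI[of _ "m + n"] exI[of _ "\<mu> * density p s T"]) auto
qed

text \<open>A Behrend set alone has dimension linear in its loss, whereas the tower starts at
  2^\<rho>; one step with Behrend sets on both sides bridges this. For densities p^(-\<delta> m) and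
  p^(-\<delta> s) the step needs (1 - 2\<delta>) s > 2\<delta> m and (1 - 3\<delta>) m > 2\<delta> s
  up to lower terms. For \<delta> < 1/3 these are compatible iff (1 - 2\<delta>)(1 - 3\<delta>) >
  4\<delta>^2, that is 1 - 5\<delta> + 2\<delta>^2 > 0. At \<delta> = 0.2185 the left side is only
  about 0.003, hence the large factor 4000.\<close>

lemma stage_base:
  assumes p: "prime p" "p \<ge> 19" and R: "R \<ge> 1" "6 * real p ^ 2 * R \<le> 2 powr (2 * \<rho>)"
    and \<rho>: "\<rho> \<ge> log 2 (real p) ^ 2" "\<rho> \<ge> 50 * log 2 (real p)"
  shows "stage p R (2 * \<rho>) (2 powr \<rho>) (2000 * \<rho>)"
proof -
  define L where "L = log 2 (real p)"
  have L: "L \<ge> 424 / 100" unfolding L_def using p log2_ge_19 by simp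
  define x where "x = \<rho> / L"
  have \<rho>': "\<rho> = L * x" using L by (simp add: x_def)
  have x: "x \<ge> L" "x \<ge> 50"
    using \<rho> L by (simp_all add: x_def field_simps power2_eq_square flip: L_def)
  define m where "m = nat \<lceil>4000 * x\<rceil>"
  have m: "4000 * x \<le> real m" "real m \<le> 4000 * x + 1" using ceiling_bounds[of "4000 * x"] x by (simp_all add: m_def)
  \<comment> \<open>The condition on \<open>s\<close>, divided by \<open>L\<close> and multiplied by
    1000, reads 437 m + 2000 x \<le> 563 s, where 437 = 2000 * 0.2185 and 563 = 1000 - 437;
    \<open>y\<close> solves it with equality.\<close>
  define y where "y = (437 * real m + 2000 * x) / 563"
  define s where "s = nat \<lceil>y\<rceil>"
  have s: "437 * real m + 2000 * x \<le> 563 * real s" "563 * real s \<le> 437 * real m + 2000 * x + 563"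
  proof -
    have y: "563 * y = 437 * real m + 2000 * x" by (simp add: y_def)
    moreover have "y \<ge> 0" using x by (simp add: y_def)
    then have "y \<le> real s" "real s \<le> y + 1" unfolding s_def by (rule ceiling_bounds)+
    ultimately show "437 * real m + 2000 * x \<le> 563 * real s" "563 * real s \<le> 437 * real m + 2000 * x + 563"
      by linarith+
  qed
  have m': "real m \<ge> 3000 * log 2 (real p)" "real m \<ge> 10 ^ 5"
    using m x by (simp_all flip: L_def)
  have s': "real s \<ge> 3000 * log 2 (real p)" "real s \<ge> 10 ^ 5"
    using s m x by (simp_all flip: L_def)
  let ?c = "2185 / 10000 * L"
  obtain S where S: "apfree p m S" and dS: "density p m S \<ge> 2 powr (- (?c * real m))"
    using dense_apfree[OF p m'] by (metis L_def)
  obtain T where T: "apfree p s T" and dT: "density p s T \<ge> 2 powr (- (?c * real s))"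
    using dense_apfree[OF p s'] by (metis L_def)
  define g where "g = L * real m - 3 * (?c * real m) - 2 * (?c * real s) - 2 * \<rho>"
  have cond: "2 * (?c * real m) + 2 * (?c * real s) + 2 * \<rho> \<le> L * real s"
  proof -
    have "L * (437 * real m + 2000 * x) \<le> L * (563 * real s)" using s L by (intro mult_left_mono) auto
    then show ?thesis unfolding \<rho>' by (simp add: algebra_simps)
  qed
  have g: "g \<ge> 16 * \<rho>"
  proof -
    have "16 * x \<le> real m - 3 * (2185 / 10000 * real m) - 2 * (2185 / 10000 * real s) - 2 * x"
      using s m x by linarith
    then have "L * (16 * x) \<le> L * (real m - 3 * (2185 / 10000 * real m) - 2 * (2185 / 10000 * real s) - 2 * x)"
      using L by (intro mult_left_mono) auto
    then show ?thesis unfolding g_def \<rho>' by (simp add: algebra_simps)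
  qed
  have \<rho>0: "\<rho> \<ge> 212" using \<rho>(2) L by (simp flip: L_def)
  have \<rho>x: "4 * x \<le> \<rho>" unfolding \<rho>' using L x by (intro mult_right_mono) auto
  have "3 * real m + 3 * real s + 1 \<le> 6 * real m" using s m x by linarith
  also have "\<dots> \<le> 500 * (16 * \<rho>)" using m \<rho>x x by linarith
  also have "\<dots> \<le> 2 powr (16 * \<rho>)" using \<rho>0 by (intro two_powr_ge_linear) linarith+
  also have "\<dots> \<le> 2 powr g" using g by simp
  finally have big: "3 * real m + 3 * real s + 1 \<le> 2 powr g" .
  have p3: "p \<ge> 3" using p by simp
  obtain n where n: "real n \<ge> 2 powr g" and sp': "sparse p R (m + n) (density p m S * density p s T)"
    by (rule sparse_step_log[OF p(1) p3 R apfree_imp_sparse[OF S] dS T dT, of g])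
      (use cond big in \<open>auto simp: g_def L_def\<close>)
  have "density p m S * density p s T \<ge> 2 powr (- (?c * real m)) * 2 powr (- (?c * real s))"
    using dS dT by (intro mult_mono) (auto intro: order_trans[OF powr_ge_zero])
  moreover have "2 powr (- (?c * real m)) * 2 powr (- (?c * real s)) \<ge> 2 powr (2 * \<rho> - 2000 * \<rho>)"
  proof -
    have "2185 / 10000 * (real m + real s) \<le> 1998 * x" unfolding distrib_left using s m x by linarith
    then have "L * (2185 / 10000 * (real m + real s)) \<le> L * (1998 * x)" using L by (intro mult_left_mono) auto
    then show ?thesis unfolding powr_add[symmetric] \<rho>' by (intro powr_mono) (simp_all add: algebra_simps)
  qed
  moreover have "L * 2 powr \<rho> + 10 * (2000 * \<rho>) \<le> L * real (m + n)"
  proof -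
    \<comment> \<open>Of the 16\<rho> in the exponent, one \<rho> reaches the tower value and
      15\<rho> pay for the reserve 20000\<rho>, which is at most 5000 \<rho> L.\<close>
    have "2 powr \<rho> * (1 + 5000 * \<rho>) \<le> 2 powr \<rho> * 2 powr (15 * \<rho>)"
    proof -
      have "1 + 5000 * \<rho> \<le> 400 * (15 * \<rho>)" using \<rho>0 by linarith
      also have "\<dots> \<le> 2 powr (15 * \<rho>)" using \<rho>0 by (intro two_powr_ge_linear) linarith+
      finally show ?thesis by (intro mult_left_mono) auto
    qed
    also have "\<dots> \<le> 2 powr g" using g by (simp flip: powr_add)
    finally have a: "2 powr \<rho> * (1 + 5000 * \<rho>) \<le> real n" using n by linarith
    have "2 powr \<rho> \<ge> 2 powr 0" using \<rho>0 by (intro powr_mono) auto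
    then have "5000 * \<rho> \<le> 2 powr \<rho> * (5000 * \<rho>)"
      using mult_right_mono[of 1 "2 powr \<rho>" "5000 * \<rho>"] \<rho>0 by simp
    then have "2 powr \<rho> + 5000 * \<rho> \<le> real n" using a by (simp add: algebra_simps)
    then have "L * (2 powr \<rho> + 5000 * \<rho>) \<le> L * real n" using L by (intro mult_left_mono) auto
    moreover have "4 * (5000 * \<rho>) \<le> L * (5000 * \<rho>)" using L \<rho>0 by (intro mult_right_mono) auto
    moreover have "0 \<le> L * real m" using L by simp
    ultimately show ?thesis unfolding of_nat_add distrib_left by linarith
  qed
  ultimately show ?thesis using sp' unfolding stage_def L_def
    by (intro exI[of _ "m + n"] exI[of _ "density p m S * density p s T"]) auto
qed

text \<open>A crude growth rate: an exponentiation gains at least p^3. It suffices to show that the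
  tower value dominates log(1/\<alpha>), as the final step requires.\<close>

lemma tow_ge_self:
  assumes "p \<ge> 19" "r \<ge> real p ^ 3"
  shows "tow (real p) k r \<ge> r * real p ^ (3 * k)"
proof (induction k)
  case (Suc k)
  define x where "x = r * real p ^ (3 * k)"
  have L: "log 2 (real p) \<ge> 4" using log2_ge_19[OF assms(1)] by simp
  have pp: "real p ^ j \<ge> 1" for j using assms by (intro one_le_power) auto
  have "r \<ge> 0" using assms(2) pp[of 3] by linarith
  then have "r * 1 \<le> x" unfolding x_def using pp[of "3 * k"] by (intro mult_left_mono) auto
  then have xp: "x \<ge> real p ^ 3" using assms by simp
  then have x0: "x \<ge> 1" using pp[of 3] by linarith
  have "x * real p ^ 3 \<le> x * x" using xp x0 by (intro mult_left_mono) auto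
  also have "\<dots> \<le> 2 / 9 * (4 * x) ^ 2" using x0 by (simp add: power2_eq_square)
  also have "\<dots> \<le> 2 powr (4 * x)" using x0 by (intro two_powr_ge_square) auto
  also have "\<dots> \<le> 2 powr (log 2 (real p) * x)" using L x0 by (intro powr_mono mult_right_mono) auto
  also have "\<dots> = real p powr x" using assms by (simp add: powr_powr[symmetric])
  also have "\<dots> \<le> real p powr (tow (real p) k r)" using Suc.IH assms by (intro powr_mono) (auto simp: x_def)
  finally show ?case by (simp add: x_def power_add mult.commute mult.left_commute)
qed simp

lemma stage_iterate:
  assumes p: "prime p" "p \<ge> 19" and R: "R \<ge> 1" "6 * real p ^ 2 * R \<le> 2 powr (2 * \<rho>)"
    and \<rho>: "\<rho> \<ge> log 2 (real p) ^ 2" "\<rho> \<ge> 50 * log 2 (real p)"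
  shows "stage p R (2 * \<rho>) (tow (real p) k (2 powr \<rho>)) (2000 * \<rho> * exp (15 / log 2 (real p) * real k))"
proof (induction k)
  case 0
  then show ?case using stage_base[OF assms] by simp
next
  case (Suc k)
  let ?L = "log 2 (real p)"
  let ?w = "2000 * \<rho> * exp (15 / ?L * real k)"
  have L: "?L \<ge> 424 / 100" using log2_ge_19[OF p(2)] .
  have \<rho>0: "\<rho> \<ge> 212" using \<rho>(2) L by simp
  have "exp (15 / ?L * real k) \<ge> 1" using L by simp
  then have w: "?w \<ge> 2000 * \<rho>" using mult_left_mono[of 1 _ "2000 * \<rho>"] \<rho>0 by simp
  have "2 powr \<rho> \<ge> 2 powr (?L * real 3)" using \<rho>(2) L by (intro powr_mono) auto
  then have "2 powr \<rho> \<ge> real p ^ 3" using power_eq_2_powr[of p 3] p by simp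
  then have "tow (real p) k (2 powr \<rho>) \<ge> 2 powr \<rho> * real p ^ (3 * k)" by (rule tow_ge_self[OF p(2)])
  moreover have "2 powr \<rho> * real p ^ (3 * k) \<ge> 1 * 1"
    using p \<rho>0 by (intro mult_mono) (auto intro: ge_one_powr_ge_zero one_le_power)
  ultimately have "tow (real p) k (2 powr \<rho>) \<ge> 1" by linarith
  then have "stage p R (2 * \<rho>) (real p powr tow (real p) k (2 powr \<rho>)) (?w * exp (15 / ?L))"
    using \<rho> \<rho>0 w by (intro stage_step[OF p R _ _ _ _ _ Suc.IH]) linarith+
  moreover have "15 / ?L * real (Suc k) = 15 / ?L * real k + 15 / ?L" using L by (simp add: field_simps)
  ultimately show ?case by (simp only: exp_add mult.assoc tow.simps)
qed

section \<open>Adjusting the density\<close>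

lemma sparse_le_1: "sparse p R m \<mu> \<Longrightarrow> p > 0 \<Longrightarrow> \<mu> \<le> 1"
proof -
  assume "sparse p R m \<mu>" "p > 0"
  then obtain S where "S \<subseteq> Fpn p m" "\<mu> = density p m S" unfolding sparse_def by blast
  moreover from this(1) have "card S \<le> p ^ m" using card_mono[OF finite_Fpn, of S p m] by simp
  then have "real (card S) \<le> real p ^ m" by (simp flip: of_nat_power)
  ultimately show ?thesis using \<open>p > 0\<close> by (simp add: density_def)
qed

text \<open>Rounding the size up to an integer at most doubles it, since the target size is at least
  1.\<close>

lemma apfree_thin:
  assumes T: "apfree p s T" and p: "p > 0" and \<tau>: "\<tau> * real p ^ s \<ge> 1" "\<tau> * real p ^ s + 1 \<le> density p s T * real p ^ s"
  obtains T' where "apfree p s T'" "density p s T' \<ge> \<tau>" "density p s T' \<le> 2 * \<tau>"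
proof -
  define c where "c = nat \<lceil>\<tau> * real p ^ s\<rceil>"
  have c: "\<tau> * real p ^ s \<le> real c" "real c \<le> \<tau> * real p ^ s + 1"
    using \<tau>(1) unfolding c_def by (auto intro: ceiling_bounds)
  have "density p s T * real p ^ s = real (card T)" using p by (simp add: density_def)
  then have "c \<le> card T" using c \<tau>(2) by linarith
  then obtain T' where T': "T' \<subseteq> T" "card T' = c" by (meson obtain_subset_with_card_n)
  have "density p s T' \<ge> \<tau>" using c p T' by (simp add: density_def field_simps)
  moreover have "density p s T' \<le> 2 * \<tau>"
  proof -
    have "real c \<le> 2 * \<tau> * real p ^ s" using c \<tau> by linarith
    then show ?thesis using p T' by (simp add: density_def field_simps)
  qed
  ultimately show ?thesis using that apfree_subset[OF T T'(1)] by blast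
qed

text \<open>The last step replaces \<open>T\<close> by a subset so as to bring the density down to \<open>\<alpha>\<close>.\<close>

lemma stage_final:
  assumes p: "prime p" "p \<ge> 19" and R: "R \<ge> 1" "6 * real p ^ 2 * R \<le> 2 powr B"
    and st: "stage p R B t w" and B: "0 \<le> B" "B \<le> w" and w: "w \<ge> 1000 * log 2 (real p) ^ 2" "w \<ge> 50000 * log 2 (real p)"
    and a: "100 * w \<le> a" "10 * a \<le> t"
  obtains m \<mu> where "sparse p R m \<mu>" "real m \<ge> t" "2 powr (- a) \<le> \<mu>" "\<mu> \<le> 2 * 2 powr (- a)"
proof -
  define L where "L = log 2 (real p)"
  have L: "L \<ge> 424 / 100" unfolding L_def using p log2_ge_19 by simp
  have p0: "p > 0" using p by simp
  obtain m \<mu> where sp: "sparse p R m \<mu>" and \<mu>: "\<mu> \<ge> 2 powr (B - w)" and m: "L * t + 10 * w \<le> L * real m"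
    using st unfolding stage_def L_def by auto
  have \<mu>0: "\<mu> > 0" using \<mu> by (metis less_le_trans powr_gt_zero zero_neq_numeral)
  define u where "u = - log 2 \<mu>"
  have \<mu>u: "\<mu> = 2 powr (- u)" using \<mu>0 by (simp add: u_def)
  have u: "0 \<le> u" "u \<le> w - B"
    using sparse_le_1[OF sp p0] \<mu>0 \<mu> le_log_iff[of 2 \<mu> "B - w"] by (auto simp: u_def)
  have w0: "w \<ge> 200000" "w \<ge> 50000 * L" using w(2) L by (simp_all flip: L_def)
  have mt: "real m \<ge> t"
  proof -
    have "L * t \<le> L * real m" using m w0 by linarith
    then show ?thesis using L by (subst (asm) mult_le_cancel_left_pos) auto
  qed
  \<comment> \<open>The set used has logarithmic loss a - u, so \<open>u\<close> cancels from the
    condition 2u + 2v + B \<le> L s.\<close>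
  define x where "x = (2 * a + B) / L"
  have xL: "L * x = 2 * a + B" using L by (simp add: x_def)
  have xa: "424 / 100 * x \<le> 2 * a + B" 
  proof -
    have "x \<ge> 0" using a w0 B L by (simp add: x_def)
    then have "424 / 100 * x \<le> L * x" using L by (intro mult_right_mono) auto
    then show ?thesis using xL by simp
  qed
  have x: "x \<ge> 3000 * L" "x \<ge> 10 ^ 5"
  proof -
    have "L * (3000 * L) \<le> 2 * a + B" using w(1) a B unfolding L_def[symmetric] by (simp add: power2_eq_square)
    then show "x \<ge> 3000 * L" using L unfolding xL[symmetric] by (subst (asm) mult_le_cancel_left_pos) auto
    have "L * 10 ^ 5 \<le> 2 * a + B" using w0 L a B by simp
    then show "x \<ge> 10 ^ 5" using L unfolding xL[symmetric] by (subst (asm) mult_le_cancel_left_pos) auto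
  qed
  define s where "s = nat \<lceil>x\<rceil>"
  have s: "x \<le> real s" "real s \<le> x + 1" using ceiling_bounds[of x] x by (simp_all add: s_def)
  have s': "real s \<ge> 3000 * log 2 (real p)" "real s \<ge> 10 ^ 5" using s x by (simp_all flip: L_def)
  obtain T where T: "apfree p s T" and dT: "density p s T \<ge> 2 powr (- (5 / 4 * real s))"
    by (rule dense_apfree[OF p s'])
  have Ls: "2 * a + B \<le> L * real s"
    unfolding xL[symmetric] using s L by (intro mult_left_mono) auto
  define \<tau> where "\<tau> = 2 powr (u - a)"
  have ps: "real p ^ s = 2 powr (L * real s)" unfolding L_def by (rule power_eq_2_powr[OF p0])
  have \<tau>ps: "\<tau> * real p ^ s = 2 powr (u - a + L * real s)" by (simp add: \<tau>_def ps powr_add)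
  have t1: "\<tau> * real p ^ s \<ge> 1"
    unfolding \<tau>ps using Ls u a w0 B by (intro ge_one_powr_ge_zero) auto
  moreover have "\<tau> * real p ^ s + 1 \<le> density p s T * real p ^ s"
  proof -
    \<comment> \<open>As \<open>L\<close> is at least 4.24, the full Behrend set loses only about
      0.6a bits, fewer than the a - u - 1 allowed: there is room to thin it.\<close>
    have "u - a + 1 \<le> - (5 / 4 * real s)" using s xa u a B w0 by linarith
    then have "2 powr (u - a + 1) \<le> density p s T" using dT by (meson order_trans powr_mono one_le_numeral)
    then have "2 * \<tau> * real p ^ s \<le> density p s T * real p ^ s"
      unfolding \<tau>_def by (intro mult_right_mono) (auto simp: powr_add)
    then show ?thesis using t1 by linarith
  qed
  ultimately obtain T' where T': "apfree p s T'" "density p s T' \<ge> \<tau>" "density p s T' \<le> 2 * \<tau>"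
    by (rule apfree_thin[OF T p0])
  define g where "g = L * real m - 3 * u - 2 * (a - u) - B"
  have tm: "10 * a \<le> real m" using mt a by linarith
  have Lm: "424 / 100 * real m \<le> L * real m" using L by (intro mult_right_mono) auto
  have g: "g \<ge> real m" using Lm tm u a w0 B unfolding g_def right_diff_distrib by linarith
  have "3 * real m + 3 * real s + 1 \<le> 6 * real m" using s xa tm a w0 B by linarith
  also have "\<dots> \<le> 2 powr real m" using tm a w0 by (intro two_powr_ge_linear) linarith+
  also have "\<dots> \<le> 2 powr g" using g by simp
  finally have big: "3 * real m + 3 * real s + 1 \<le> 2 powr g" .
  have p3: "p \<ge> 3" using p by simp
  have \<tau>': "density p s T' \<ge> 2 powr (- (a - u))" using T'(2) by (simp add: \<tau>_def)
  obtain n where "real n \<ge> 2 powr g" and sp': "sparse p R (m + n) (\<mu> * density p s T')"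
    by (rule sparse_step_log[OF p(1) p3 R sp _ T'(1) \<tau>', of u g])
      (use Ls big \<mu>u in \<open>auto simp: g_def L_def\<close>)
  have \<mu>\<tau>: "\<mu> * \<tau> = 2 powr (- a)" by (simp add: \<mu>u \<tau>_def flip: powr_add)
  show ?thesis
  proof (rule that[OF sp'])
    show "real (m + n) \<ge> t" using mt by simp
    show "2 powr (- a) \<le> \<mu> * density p s T'"
      using mult_left_mono[OF T'(2), of \<mu>] \<mu>0 \<mu>\<tau> by simp
    show "\<mu> * density p s T' \<le> 2 * 2 powr (- a)"
      using mult_left_mono[OF T'(3), of \<mu>] \<mu>0 by (simp flip: \<mu>\<tau>)
  qed
qed

theorem theorem8:
  fixes p :: nat and \<alpha> \<beta> :: real
  assumes "prime p" and "p \<ge> 19"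
    and "0 < \<alpha>" and "\<alpha> \<le> 1/2"
    and "\<alpha> powr (3 + exp (-133)) \<le> \<beta>"
    and "\<beta> \<le> \<alpha> ^ 3 * min (real p powr (- log 2 (real p))) (real p powr (-50))"
  shows "\<exists>n::nat. real n \<ge> Tow (real p)
              ((1/30) * log 2 (real p) * ln (log 2 (1/\<alpha>) / log 2 (\<alpha> ^ 3 / \<beta>)))
              (\<alpha> ^ 3 / \<beta>)
         \<and> (\<exists>A. A \<subseteq> Fpn p n \<and> density p n A \<ge> \<alpha>
              \<and> (\<forall>d\<in>Fpn p n. d \<noteq> (\<lambda>_. 0) \<longrightarrow> ap3_density p n A d < \<beta>))"
proof -
  define L where "L = log 2 (real p)"
  define r where "r = \<alpha> ^ 3 / \<beta>"
  define \<rho> where "\<rho> = log 2 r"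
  define a where "a = log 2 (1 / \<alpha>)"
  define q where "q = a / \<rho>"
  have L: "L \<ge> 424 / 100" unfolding L_def using assms log2_ge_19 by simp
  have p0: "p > 0" using assms by simp
  have \<beta>0: "\<beta> > 0" using assms by (metis less_le_trans powr_gt_zero less_numeral_extra(3))
  have r0: "r > 0" using assms \<beta>0 by (simp add: r_def)
  have r\<rho>: "r = 2 powr \<rho>" using r0 by (simp add: \<rho>_def)
  have \<alpha>a: "\<alpha> = 2 powr (- a)" using assms by (simp add: a_def log_divide)
  have a1: "a \<ge> 1"
  proof -
    have "log 2 2 \<le> a" unfolding a_def using assms by (subst log_le_cancel_iff) (auto simp: field_simps)
    then show ?thesis by simp
  qed
  have lower: "2 powr c \<le> r" if c: "real p powr (- c / L) \<ge> \<beta> / \<alpha> ^ 3" for c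
  proof -
    have "real p powr (- c / L) = 2 powr (- c)"
    proof -
      have "real p = 2 powr L" using p0 by (simp add: L_def)
      then show ?thesis using L by (simp add: powr_powr)
    qed
    then have "\<beta> / \<alpha> ^ 3 \<le> 2 powr (- c)" using c by simp
    then have "\<beta> * 2 powr c \<le> \<alpha> ^ 3" using assms by (simp add: powr_minus field_simps)
    then show ?thesis using \<beta>0 by (simp add: r_def field_simps)
  qed
  \<comment> \<open>The two entries of the minimum become \<rho> \<ge> L^2 and \<rho> \<ge> 50 L,
    which keep the dimensions of all Behrend sets above 3000 L and 10^5.\<close>
  have min: "\<beta> / \<alpha> ^ 3 \<le> real p powr (- L)" "\<beta> / \<alpha> ^ 3 \<le> real p powr (- 50)"
  proof -
    have "\<beta> / \<alpha> ^ 3 \<le> min (real p powr (- L)) (real p powr (- 50))"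
      using assms(3,6) by (simp only: pos_divide_le_eq zero_less_power L_def mult.commute)
    then show "\<beta> / \<alpha> ^ 3 \<le> real p powr (- L)" "\<beta> / \<alpha> ^ 3 \<le> real p powr (- 50)" by simp_all
  qed
  have \<rho>1: "\<rho> \<ge> L ^ 2"
    using lower[of "L ^ 2"] min(1) L r\<rho> by (simp add: power2_eq_square)
  have \<rho>2: "\<rho> \<ge> 50 * L"
    using lower[of "50 * L"] min(2) L r\<rho> by simp
  have \<rho>0: "\<rho> \<ge> 212" using \<rho>2 L by simp
  \<comment> \<open>The lower bound on \<beta> says \<rho> \<le> a exp(-133). It yields both
    \<open>k \<ge> 17\<close>, as 4.24 * 133 / 30 > 18, and sqrt q \<ge> 200000.\<close>
  have q: "ln q \<ge> 133"
  proof -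
    have "\<alpha> powr 3 * \<alpha> powr exp (- 133) \<le> \<beta>" using assms(5) by (simp add: powr_add)
    then have "r \<le> 1 / \<alpha> powr exp (- 133)"
      using assms(3) \<beta>0 by (simp add: r_def field_simps)
    also have "\<dots> = 2 powr (a * exp (- 133))" 
      unfolding \<alpha>a by (simp only: powr_powr powr_minus_divide[symmetric] mult_minus_left minus_minus)
    finally have "\<rho> \<le> a * exp (- 133)" unfolding r\<rho> by simp
    then have "exp 133 \<le> q" using \<rho>0 by (simp add: q_def exp_minus field_simps)
    moreover have "0 < q" using a1 \<rho>0 by (simp add: q_def)
    ultimately show ?thesis by (simp add: ln_ge_iff)
  qed
  have q0: "q > 0" using a1 \<rho>0 by (simp add: q_def)
  have aq: "a = q * \<rho>" using \<rho>0 by (simp add: q_def)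
  \<comment> \<open>Here 30 = 2 * 15: after \<open>k\<close> levels the loss has grown by exp(15 k /
    L), at most sqrt q. The other sqrt q pays for 200000, the initial 2000 times the ratio 100 asked
    for by the last step.\<close>
  define h where "h = (1/30) * L * ln q"
  define k where "k = nat \<lfloor>h\<rfloor>"
  have h0: "h \<ge> 0" unfolding h_def using L q by simp
  have k: "real k \<le> h" "h < real k + 1" using h0 unfolding k_def by linarith+
  define w where "w = 2000 * \<rho> * exp (15 / L * real k)"
  \<comment> \<open>The final density is only known to be at most 2\<alpha>, which costs a factor 8
    in the cube; 16 instead of 8 leaves \<beta>/2 and makes the inequality strict. The exponent 7
    below comes from 6 * 16 \<le> 2^7.\<close>
  have R: "(16 * r :: real) \<ge> 1" "6 * real p ^ 2 * (16 * r) \<le> 2 powr (2 * \<rho>)"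
  proof -
    have "2 powr \<rho> \<ge> 2 powr 0" using \<rho>0 by (intro powr_mono) auto
    then show "16 * r \<ge> 1" using r\<rho> by simp
    have "6 * real p ^ 2 * 16 \<le> 2 powr (7 + 2 * L)"
      using power_eq_2_powr[OF p0, of 2] by (simp add: powr_add L_def mult.commute)
    also have "\<dots> \<le> 2 powr \<rho>" using \<rho>2 L by (intro powr_mono) auto
    finally have "6 * real p ^ 2 * 16 * r \<le> 2 powr \<rho> * r" using r0 by (intro mult_right_mono) auto
    then show "6 * real p ^ 2 * (16 * r) \<le> 2 powr (2 * \<rho>)"
      by (simp add: r\<rho> mult.assoc flip: powr_add)
  qed
  have st: "stage p (16 * r) (2 * \<rho>) (tow (real p) k r) w"
    using stage_iterate[OF assms(1,2) R, of k] \<rho>1 \<rho>2 unfolding w_def r\<rho> L_def by simp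
  have w: "w \<ge> 2000 * \<rho>" "100 * w \<le> a"
  proof -
    have "15 / L * real k \<ge> 0" using L by simp
    then have "exp (15 / L * real k) \<ge> 1" by simp
    then show "w \<ge> 2000 * \<rho>" unfolding w_def using mult_left_mono[of 1 _ "2000 * \<rho>"] \<rho>0 by simp
    have "15 / L * real k \<le> 15 / L * h" using k L by (intro mult_left_mono) auto
    also have "\<dots> = ln q / 2" using L by (simp add: h_def)
    finally have e1: "exp (15 / L * real k) \<le> exp (ln q / 2)" by simp
    have "200000 \<le> exp (ln q / 2)"
    proof -
      have "(200000::real) \<le> 2 ^ 18" by simp
      also have "\<dots> \<le> exp 1 ^ 18" using exp_ge_add_one_self[of 1] by (intro power_mono) auto
      also have "\<dots> = exp (of_nat 18 * 1)" by (rule exp_of_nat_mult[symmetric])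
      also have "\<dots> \<le> exp (ln q / 2)" using q by (subst exp_le_cancel_iff) simp
      finally show ?thesis .
    qed
    then have "200000 * exp (15 / L * real k) \<le> exp (ln q / 2) * exp (ln q / 2)"
      using e1 by (intro mult_mono) auto
    also have "\<dots> = q" using q0 by (simp flip: exp_add)
    finally have "200000 * exp (15 / L * real k) * \<rho> \<le> q * \<rho>" using \<rho>0 by (intro mult_right_mono) auto
    then show "100 * w \<le> a" unfolding w_def aq by (simp add: mult_ac)
  qed
  \<comment> \<open>Write a = q \<rho>: \<open>k\<close> levels of the tower gain p^(3k), which
    exceeds \<open>q\<close> because ln q \<le> 8k, and the starting value r = 2^\<rho> exceeds
    10\<rho>.\<close>
  have at: "10 * a \<le> tow (real p) k r"
  proof -
    have k17: "real k \<ge> 17"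
    proof -
      have "424 / 100 * 133 \<le> L * ln q" using L q by (intro mult_mono) auto
      then show ?thesis using k(2) unfolding h_def by simp
    qed
    have "ln q \<le> 3 * real k * ln (real p)"
    proof -
      have "L * ln q \<le> 30 * real k + 30" using k(2) unfolding h_def by simp
      moreover have "424 / 100 * ln q \<le> L * ln q" using L q by (intro mult_right_mono) auto
      ultimately have "ln q \<le> 8 * real k" using k17 by linarith
      moreover have "ln (real p) \<ge> 424 / 100 * (2 / 3)"
      proof -
        have "ln (real p) = L * ln 2" by (simp add: L_def log_def)
        moreover have "424 / 100 * (2 / 3) \<le> L * ln 2" using L ln2_ge_two_thirds by (intro mult_mono) auto
        ultimately show ?thesis by simp
      qed
      then have "3 * real k * (424 / 100 * (2 / 3)) \<le> 3 * real k * ln (real p)" by (intro mult_left_mono) auto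
      ultimately show ?thesis by linarith
    qed
    also have "\<dots> = ln (real p ^ (3 * k))" using p0 by (simp add: ln_realpow)
    finally have "q \<le> real p ^ (3 * k)" using q0 p0 by simp
    moreover have "10 * \<rho> \<le> r" unfolding r\<rho> using \<rho>0 by (intro two_powr_ge_linear) auto
    ultimately have "q * (10 * \<rho>) \<le> real p ^ (3 * k) * r" using q0 \<rho>0 by (intro mult_mono) auto
    also have "\<dots> \<le> tow (real p) k r"
    proof -
      have "2 powr (L * real 3) \<le> r" unfolding r\<rho> using \<rho>2 L by (intro powr_mono) auto
      then have "real p ^ 3 \<le> r" using power_eq_2_powr[OF p0, of 3] by (simp add: L_def)
      then show ?thesis using tow_ge_self[OF assms(2), of r k] by (simp add: mult.commute)
    qed
    finally show ?thesis by (simp add: aq)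
  qed
  obtain n \<mu> where sp: "sparse p (16 * r) n \<mu>" and n: "real n \<ge> tow (real p) k r"
    and \<mu>: "2 powr (- a) \<le> \<mu>" "\<mu> \<le> 2 * 2 powr (- a)"
    by (rule stage_final[OF assms(1,2) R st _ _ _ _ w(2) at])
      (use w \<rho>0 \<rho>1 \<rho>2 in \<open>auto simp flip: L_def\<close>)
  then obtain A where A: "A \<subseteq> Fpn p n" "density p n A = \<mu>"
    and ap: "\<And>d. d \<in> Fpn p n \<Longrightarrow> d \<noteq> (\<lambda>_. 0) \<Longrightarrow> ap3_density p n A d * (16 * r) \<le> \<mu> ^ 3"
    unfolding sparse_def by blast
  have "ap3_density p n A d < \<beta>" if d: "d \<in> Fpn p n" "d \<noteq> (\<lambda>_. 0)" for d
  proof -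
    have "ap3_density p n A d * (16 * r) \<le> \<mu> ^ 3" by (rule ap[OF d])
    also have "\<dots> \<le> (2 * \<alpha>) ^ 3"
      using \<mu> \<alpha>a assms(3) by (intro power_mono) auto
    also have "\<dots> = 8 * (\<beta> * r)" using \<beta>0 by (simp add: r_def power_mult_distrib)
    finally have "r * (2 * ap3_density p n A d) \<le> r * \<beta>" by (simp add: mult_ac)
    then show ?thesis using r0 \<beta>0 by (subst (asm) mult_le_cancel_left_pos) auto
  qed
  moreover have "Tow (real p) ((1/30) * log 2 (real p) * ln (log 2 (1/\<alpha>) / log 2 (\<alpha> ^ 3 / \<beta>))) (\<alpha> ^ 3 / \<beta>)
      = tow (real p) k r"
    by (simp add: Tow_def k_def h_def q_def a_def \<rho>_def r_def L_def)
  moreover have "density p n A \<ge> \<alpha>" using A \<mu> \<alpha>a by simp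
  ultimately show ?thesis using n A(1) by (intro exI[of _ n]) auto
qed

end
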